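(* Let $\Omega$ be a measure space, let $Z$ be an index set and suppose that $2\leq p<\infty$. For any $z\in Z$, consider a bounded integral operator $\mathcal{C}_{k_z}\colon \mathrm{L}^p(\Omega)\to \mathrm{L}^p(\Omega)$ with kernel $k_z$. Suppose that the family $(k_z)_{z\in Z}$ has an $\mathrm{L}^{\frac{p}{p-2}}$-square-max decomposition. Then the family $(\mathcal{C}_{k_z})_{z\in Z}$ is $R$-bounded on $\mathrm{L}^p(\Omega)$.
   Context: For a measurable $k\colon\Omega\times\Omega\to\mathbb{C}$ (with suitable integrability), $(\mathcal{C}_kf)(x)=\int_\Omega k(x,y)f(y)\,dy$, and $\check k(x,y)=k(y,x)$. Let $1\leq q\leq\infty$. A family $(k_z)_{z\in Z}$ of functions $k_z\colon\Omega\times\Omega\to\mathbb{C}$ admits an $\mathrm{L}^q$-square-max decomposition if there are measurable functions $s_z,m_z\colon\Omega\times\Omega\to\mathbb{C}$ with $k_z=s_zm_z$ such that $$\sup_{z\in Z}\sup_{x\in\Omega}\|s_z(x,\cdot)\|_{\mathrm{L}^2(\Omega)}<\infty$$ and there is a constant $C$ with $$\Big\|{\sup_{z\in Z}}^+\,\mathcal{C}_{|\check m_z|^2}(f)\Big\|_{\mathrm{L}^q(\Omega)}\leq C\|f\|_{\mathrm{L}^q(\Omega)}\quad\text{for all } f\in \mathrm{L}^q(\Omega).$$ Here $\|\sup_i^+x_i\|_{\mathrm{L}^q(\Omega)}$ is the norm of $(x_i)$ in $\mathrm{L}^q(\Omega,\ell^\infty_I)$; for nonnegative $x_i$ it equals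 $\inf\{\|y\|_{\mathrm{L}^q(\Omega)}:x_i\leq y\text{ for all } i\}$. For $p=2$ we read $\frac{p}{p-2}=\infty$. $R$-boundedness. A set $\mathcal{F}$ of bounded operators on a Banach space $Y$ is $R$-bounded if there is $C\geq0$ such that for all $N$, all $T_1,\ldots,T_N\in\mathcal{F}$ and $x_1,\ldots,x_N\in Y$, $\|\sum_k\varepsilon_k\otimes T_kx_k\|_{\mathrm{L}^r(\Omega_0,Y)}\leq C\|\sum_k\varepsilon_k\otimes x_k\|_{\mathrm{L}^r(\Omega_0,Y)}$, where $(\varepsilon_k)$ are independent Rademacher variables on a probability space $\Omega_0$ (the property does not depend on $r\in(1,\infty)$). *)

theory Defs
  imports "HOL-Probability.Probability" "HOL-Probability.Essential_Supremum"
    "HOL-Library.Function_Algebras"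
begin

instantiation "fun" :: (type, real_vector) real_vector
begin

definition "c *\<^sub>R f = (\<lambda>x. c *\<^sub>R f x)"

instance
  by standard (simp_all add: scaleR_fun_def fun_eq_iff scaleR_add_left scaleR_add_right)

end

(* Elements of L^q(M) are represented by measurable functions. Lp_norm is a seminorm on these
   whose null vectors are the functions vanishing almost everywhere. *)

definition Lp_norm ::
    "'a measure \<Rightarrow> ennreal \<Rightarrow> ('a \<Rightarrow> 'b::real_normed_vector) \<Rightarrow> ennreal" where
  "Lp_norm M q f =
     (if q = \<infinity> then esssup M (\<lambda>x. ennreal (norm (f x)))
      else let I = \<integral>\<^sup>+x. ennreal (norm (f x) powr enn2real q) \<partial>M
           in if I = \<infinity> then \<infinity> else ennreal (enn2real I powr (1 / enn2real q)))"

definition Lp_space :: "'a measure \<Rightarrow> ennreal \<Rightarrow> ('a \<Rightarrow> complex) set" where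
  "Lp_space M q = {f \<in> borel_measurable M. Lp_norm M q f < \<infinity>}"

definition kernel_op ::
    "'a measure \<Rightarrow> ('a \<Rightarrow> 'a \<Rightarrow> complex) \<Rightarrow> ('a \<Rightarrow> complex) \<Rightarrow> 'a \<Rightarrow> complex" where
  "kernel_op M k f = (\<lambda>x. \<integral>y. k x y * f y \<partial>M)"

(* The Bochner integral of a non-integrable function is 0 by convention, so the existence of the
   integrals defining kernel_op has to be required separately. *)
definition kernel_op_exists ::
    "'a measure \<Rightarrow> ennreal \<Rightarrow> ('a \<Rightarrow> 'a \<Rightarrow> complex) \<Rightarrow> bool" where
  "kernel_op_exists M q k \<longleftrightarrow>
     (\<forall>f\<in>Lp_space M q. AE x in M. integrable M (\<lambda>y. k x y * f y))"

definition flip_kernel :: "('a \<Rightarrow> 'a \<Rightarrow> 'b) \<Rightarrow> 'a \<Rightarrow> 'a \<Rightarrow> 'b" where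
  "flip_kernel k = (\<lambda>x y. k y x)"

(* The norm of the family (F z) in L^q(M, l^infinity(Z)): for complex-valued functions the least
   L^q norm of a common almost-everywhere majorant of the absolute values. It is infinite if
   there is no majorant in L^q. *)
definition sup_plus_norm ::
    "'a measure \<Rightarrow> ennreal \<Rightarrow> 'z set \<Rightarrow> ('z \<Rightarrow> 'a \<Rightarrow> complex) \<Rightarrow> ennreal" where
  "sup_plus_norm M q Z F =
     (INF g\<in>{g :: 'a \<Rightarrow> real. g \<in> borel_measurable M \<and> (\<forall>z\<in>Z. AE x in M. norm (F z x) \<le> g x)}.
        Lp_norm M q g)"

definition square_max_decomposition ::
    "'a measure \<Rightarrow> ennreal \<Rightarrow> 'z set \<Rightarrow> ('z \<Rightarrow> 'a \<Rightarrow> 'a \<Rightarrow> complex) \<Rightarrow> bool" where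
  "square_max_decomposition M q Z k \<longleftrightarrow>
     (\<exists>s m :: 'z \<Rightarrow> 'a \<Rightarrow> 'a \<Rightarrow> complex.
        (\<forall>z\<in>Z. case_prod (s z) \<in> borel_measurable (M \<Otimes>\<^sub>M M)) \<and>
        (\<forall>z\<in>Z. case_prod (m z) \<in> borel_measurable (M \<Otimes>\<^sub>M M)) \<and>
        (\<forall>z\<in>Z. \<forall>x\<in>space M. \<forall>y\<in>space M. k z x y = s z x y * m z x y) \<and>
        (SUP z\<in>Z. SUP x\<in>space M. Lp_norm M 2 (s z x)) < \<infinity> \<and>
        (let K = (\<lambda>z x y. complex_of_real ((cmod (flip_kernel (m z) x y))\<^sup>2)) in
          (\<forall>z\<in>Z. kernel_op_exists M q (K z)) \<and>
          (\<exists>C::real. \<forall>f\<in>Lp_space M q.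
             sup_plus_norm M q Z (\<lambda>z. kernel_op M (K z) f) \<le> ennreal C * Lp_norm M q f)))"

(* Below, a normed space Y is presented by a subspace V of a vector space together with a
   seminorm N on V; its elements are the classes modulo null vectors of N. Accordingly an operator
   acts on representatives and is linear up to null vectors. *)

definition bounded_operator :: "'v::real_vector set \<Rightarrow> ('v \<Rightarrow> real) \<Rightarrow> ('v \<Rightarrow> 'v) \<Rightarrow> bool" where
  "bounded_operator V N T \<longleftrightarrow>
     (\<forall>f\<in>V. T f \<in> V) \<and>
     (\<forall>f\<in>V. \<forall>g\<in>V. \<forall>a b. N (T (a *\<^sub>R f + b *\<^sub>R g) - (a *\<^sub>R T f + b *\<^sub>R T g)) = 0) \<and>
     (\<exists>C\<ge>0. \<forall>f\<in>V. N (T f) \<le> C * N f)"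

definition bounded_integral_operator ::
    "'a measure \<Rightarrow> ennreal \<Rightarrow> ('a \<Rightarrow> 'a \<Rightarrow> complex) \<Rightarrow> bool" where
  "bounded_integral_operator M q k \<longleftrightarrow>
     case_prod k \<in> borel_measurable (M \<Otimes>\<^sub>M M) \<and>
     kernel_op_exists M q k \<and>
     bounded_operator (Lp_space M q) (\<lambda>f. enn2real (Lp_norm M q f)) (kernel_op M k)"

definition rademacher_sequence :: "'w measure \<Rightarrow> (nat \<Rightarrow> 'w \<Rightarrow> real) \<Rightarrow> bool" where
  "rademacher_sequence P \<epsilon> \<longleftrightarrow>
     prob_space P \<and> prob_space.indep_vars P (\<lambda>_. borel) \<epsilon> UNIV \<and>
     (\<forall>i. measure P {\<omega>\<in>space P. \<epsilon> i \<omega> = 1} = 1 / 2 \<and>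
          measure P {\<omega>\<in>space P. \<epsilon> i \<omega> = -1} = 1 / 2)"

(* R-boundedness with respect to the norms of L^r(P, Y). *)
definition R_bounded ::
    "'w measure \<Rightarrow> (nat \<Rightarrow> 'w \<Rightarrow> real) \<Rightarrow> real \<Rightarrow>
     'v::real_vector set \<Rightarrow> ('v \<Rightarrow> real) \<Rightarrow> ('v \<Rightarrow> 'v) set \<Rightarrow> bool" where
  "R_bounded P \<epsilon> r V N \<T> \<longleftrightarrow>
     (\<forall>T\<in>\<T>. bounded_operator V N T) \<and>
     (\<exists>C\<ge>0. \<forall>n::nat. \<forall>T x. (\<forall>i<n. T i \<in> \<T> \<and> x i \<in> V) \<longrightarrow>
        Lp_norm P (ennreal r) (\<lambda>\<omega>. N (\<Sum>i<n. \<epsilon> i \<omega> *\<^sub>R T i (x i)))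
          \<le> ennreal C * Lp_norm P (ennreal r) (\<lambda>\<omega>. N (\<Sum>i<n. \<epsilon> i \<omega> *\<^sub>R x i)))"

end

theory Submission
  imports Defs
begin

text \<open>By the Kahane--Khintchine inequalities, \<open>R\<close>-boundedness on \<open>L\<^sup>p\<close> amounts to a square function
  estimate for \<open>h = \<Sum>\<^sub>i |T\<^sub>i f\<^sub>i|\<^sup>2\<close> against \<open>\<Sum>\<^sub>i |f\<^sub>i|\<^sup>2\<close> in \<open>L\<close> with exponent \<open>p/2\<close>. By Cauchy--Schwarz,
  \<open>|T\<^sub>i f\<^sub>i|\<^sup>2\<close> is at most a constant times the integral of \<open>|m\<^sub>i(x,y)|\<^sup>2 |f\<^sub>i(y)|\<^sup>2\<close> over \<open>y\<close>. Pairing with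
  \<open>g = h\<close> to the power \<open>p/2 - 1\<close>, which lies in the dual space, and exchanging the integrals moves
  the kernels \<open>|m\<^sub>i|\<^sup>2\<close> onto \<open>g\<close>, where the maximal inequality provides one majorant for all \<open>i\<close>.

  Since only finitely many Rademacher variables occur at a time, all expectations are averages
  over sign vectors.\<close>

section \<open>Khintchine inequalities for sign vectors\<close>

text \<open>The randomised norms carry an arbitrary exponent \<open>r\<close>. With \<open>Y\<close>
  the p-th power of the L^p norm of a signed sum, they are governed by averages of
  \<open>Y powr (r / p)\<close>. For r = p, exchanging average and integral would reduce them to
  scalar Khintchine inequalities; for other \<open>r\<close> the moments of \<open>Y\<close> itself
  have to be compared with the integral of the p-th power of the square function, with constants
  independent of the number of operators.

  In the square function estimate p/2 and p/(p-2) are conjugate exponents. For p > 2 the test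
  function \<open>g\<close> is built from the output so that the integral of \<open>g * h\<close>
  and that of g^(p/(p-2)) are both the integral of h^(p/2). This unknown therefore occurs on both
  sides. Young's inequality gives it the coefficient 1/2 on the right, where it is absorbed; this is
  legitimate because the operators map into L^p, which makes it finite. For p = 2 the function
  \<open>g\<close> has values 0 and 1, and the L^infinity bound applies directly.\<close>

abbreviation sign_vectors :: "nat \<Rightarrow> (nat \<Rightarrow> real) set" where
  "sign_vectors n \<equiv> {..<n} \<rightarrow>\<^sub>E {-1, 1}"

lemma finite_sign_vectors: "finite (sign_vectors n)"
  by (intro finite_PiE) auto

lemma card_sign_vectors: "card (sign_vectors n) = 2 ^ n"
  by (simp add: card_PiE numeral_2_eq_2)

text \<open>Conditioning on the last sign; it drives the inductions for the exponential moment and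
  for the second moment.\<close>

lemma sum_sign_vectors_Suc:
  "(\<Sum>\<sigma>\<in>sign_vectors (Suc n). \<phi> \<sigma>) =
     (\<Sum>\<sigma>\<in>sign_vectors n. \<phi> (\<sigma>(n := 1)) + \<phi> (\<sigma>(n := -1)))"
proof -
  have inj: "inj_on (\<lambda>(y, g). g(n := y)) ({-1, 1::real} \<times> sign_vectors n)"
    by (intro inj_combinator) auto
  have "(\<Sum>\<sigma>\<in>sign_vectors (Suc n). \<phi> \<sigma>) =
      (\<Sum>(y, g)\<in>{-1, 1} \<times> sign_vectors n. \<phi> (g(n := y)))"
    unfolding lessThan_Suc PiE_insert_eq
    by (subst sum.reindex[OF inj]) (simp add: case_prod_unfold)
  also have "\<dots> = (\<Sum>y\<in>{-1, 1}. \<Sum>g\<in>sign_vectors n. \<phi> (g(n := y)))"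
    by (rule sum.cartesian_product[symmetric])
  also have "\<dots> = (\<Sum>\<sigma>\<in>sign_vectors n. \<phi> (\<sigma>(n := 1)) + \<phi> (\<sigma>(n := -1)))"
    by (simp add: sum.distrib add.commute)
  finally show ?thesis .
qed

text \<open>A weak form of cosh a <= exp(a^2/2) with an elementary proof: for 0 <= a <= 1 the linear
  terms of the two quadratic bounds cancel, and for a > 1 one has a <= a^2.\<close>

lemma exp_add_exp_minus_le: "exp (a::real) + exp (-a) \<le> 2 * exp (a\<^sup>2)"
proof -
  have *: "exp a + exp (-a) \<le> 2 * exp (a\<^sup>2)" if "a \<ge> 0" for a :: real
  proof (cases "a \<le> 1")
    case True
    have "exp a \<le> 1 + a + a\<^sup>2" using that True by (rule exp_bound)
    moreover have "exp (-a) \<le> 1 - a + a\<^sup>2"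
    proof -
      have "exp (-a) \<le> 1 / (1 + a)"
        using that exp_ge_add_one_self[of a] by (simp add: exp_minus field_simps)
      \<comment> \<open>The product of 1 + a and 1 - a + a^2 is 1 + a^3.\<close>
      also have "1 / (1 + a) \<le> 1 - a + a\<^sup>2"
        using that by (simp add: field_simps power2_eq_square power3_eq_cube)
      finally show ?thesis .
    qed
    moreover have "1 + a\<^sup>2 \<le> exp (a\<^sup>2)" by (rule exp_ge_add_one_self)
    ultimately show ?thesis by linarith
  next
    case False
    then have "a \<le> a\<^sup>2" by (simp add: power2_eq_square)
    then have "exp a \<le> exp (a\<^sup>2)" "exp (-a) \<le> exp (a\<^sup>2)" using that by simp_all
    then show ?thesis by linarith
  qed
  show ?thesis using *[of a] *[of "-a"] by (cases "a \<ge> 0") auto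
qed

text \<open>The subgaussian estimate: by independence each sign contributes one factor of the
  exponential moment.\<close>

lemma sum_sign_vectors_exp_le:
  "(\<Sum>\<sigma>\<in>sign_vectors n. exp (\<Sum>i<n. \<sigma> i * a i)) \<le> 2 ^ n * exp (\<Sum>i<n. (a i)\<^sup>2)"
proof (induction n)
  case (Suc n)
  have "(\<Sum>\<sigma>\<in>sign_vectors (Suc n). exp (\<Sum>i<Suc n. \<sigma> i * a i)) =
      (\<Sum>\<sigma>\<in>sign_vectors n. exp (\<Sum>i<n. \<sigma> i * a i)) * (exp (a n) + exp (- a n))"
    by (simp add: sum_sign_vectors_Suc exp_add sum_distrib_right distrib_left sum.distrib)
  also have "\<dots> \<le> (2 ^ n * exp (\<Sum>i<n. (a i)\<^sup>2)) * (2 * exp ((a n)\<^sup>2))"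
    by (intro mult_mono Suc exp_add_exp_minus_le) (auto intro: add_nonneg_nonneg)
  also have "\<dots> = 2 ^ Suc n * exp (\<Sum>i<Suc n. (a i)\<^sup>2)"
    by (simp add: exp_add)
  finally show ?case .
qed simp

lemma powr_le_exp:
  assumes "R > 0" "t \<ge> (0::real)"
  shows "t powr R \<le> R powr R * exp t"
proof -
  have "t / R \<le> exp (t / R)" using exp_ge_add_one_self[of "t / R"] by linarith
  then have "(t / R) powr R \<le> exp (t / R) powr R" using assms by (intro powr_mono2) auto
  also have "\<dots> = exp t" using assms by (simp add: exp_powr_real)
  finally show ?thesis using assms by (simp add: powr_divide field_simps)
qed

text \<open>By homogeneity the square sum may be taken to be 1. Then \<open>powr_le_exp\<close>
  bounds the R-th power by R^R times exp t + exp (-t), and the exponential moments of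
  \<open>b\<close> and \<open>-b\<close> contribute a factor e each.\<close>

lemma khintchine_upper_real:
  fixes a :: "nat \<Rightarrow> real"
  assumes "R > 0"
  shows "(\<Sum>\<sigma>\<in>sign_vectors n. \<bar>\<Sum>i<n. \<sigma> i * a i\<bar> powr R)
    \<le> 2 ^ n * (2 * exp 1 * R powr R) * (\<Sum>i<n. (a i)\<^sup>2) powr (R / 2)"
proof (cases "(\<Sum>i<n. (a i)\<^sup>2) = 0")
  case True
  then have "\<forall>i<n. a i = 0" by (subst (asm) sum_nonneg_eq_0_iff) auto
  then show ?thesis by simp
next
  case False
  define A where "A = (\<Sum>i<n. (a i)\<^sup>2)"
  have "A \<ge> 0" unfolding A_def by (intro sum_nonneg) auto
  with False have A: "A > 0" by (simp add: A_def)
  define b where "b i = a i / sqrt A" for i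
  have b: "(\<Sum>i<n. (b i)\<^sup>2) = 1"
    using A by (simp add: b_def power_divide sum_divide_distrib[symmetric] A_def[symmetric])
  have ab: "(\<Sum>i<n. \<sigma> i * a i) = sqrt A * (\<Sum>i<n. \<sigma> i * b i)" for \<sigma>
    using A by (simp add: b_def sum_distrib_left)
  have e: "(\<Sum>\<sigma>\<in>sign_vectors n. exp (\<Sum>i<n. \<sigma> i * b i)) \<le> 2 ^ n * exp 1"
    "(\<Sum>\<sigma>\<in>sign_vectors n. exp (- (\<Sum>i<n. \<sigma> i * b i))) \<le> 2 ^ n * exp 1"
    using sum_sign_vectors_exp_le[where n = n and a = b] sum_sign_vectors_exp_le[where n = n and a = "\<lambda>i. - b i"]
    by (simp_all add: b sum_negf)
  have "\<bar>t\<bar> powr R \<le> R powr R * (exp t + exp (-t))" for t :: real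
  proof -
    have "\<bar>t\<bar> powr R \<le> R powr R * exp \<bar>t\<bar>" using assms by (intro powr_le_exp) auto
    also have "\<dots> \<le> R powr R * (exp t + exp (-t))" by (intro mult_left_mono) (auto simp: abs_if)
    finally show ?thesis .
  qed
  then have "(\<Sum>\<sigma>\<in>sign_vectors n. \<bar>\<Sum>i<n. \<sigma> i * b i\<bar> powr R)
      \<le> (\<Sum>\<sigma>\<in>sign_vectors n. R powr R * (exp (\<Sum>i<n. \<sigma> i * b i) + exp (- (\<Sum>i<n. \<sigma> i * b i))))"
    by (intro sum_mono)
  also have "\<dots> = R powr R * ((\<Sum>\<sigma>\<in>sign_vectors n. exp (\<Sum>i<n. \<sigma> i * b i))
      + (\<Sum>\<sigma>\<in>sign_vectors n. exp (- (\<Sum>i<n. \<sigma> i * b i))))"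
    by (simp add: sum_distrib_left sum.distrib distrib_left)
  also have "\<dots> \<le> R powr R * (2 ^ n * exp 1 + 2 ^ n * exp 1)"
    by (intro mult_left_mono add_mono e) auto
  finally have *: "(\<Sum>\<sigma>\<in>sign_vectors n. \<bar>\<Sum>i<n. \<sigma> i * b i\<bar> powr R)
    \<le> 2 ^ n * (2 * exp 1 * R powr R)" by (simp add: algebra_simps)
  have "\<bar>sqrt A * t\<bar> powr R = A powr (R / 2) * \<bar>t\<bar> powr R" for t
    using A by (simp add: abs_mult powr_mult powr_half_sqrt[symmetric] powr_powr)
  then have "(\<Sum>\<sigma>\<in>sign_vectors n. \<bar>\<Sum>i<n. \<sigma> i * a i\<bar> powr R) =
      A powr (R / 2) * (\<Sum>\<sigma>\<in>sign_vectors n. \<bar>\<Sum>i<n. \<sigma> i * b i\<bar> powr R)"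
    by (simp only: ab sum_distrib_left[symmetric])
  also have "\<dots> \<le> A powr (R / 2) * (2 ^ n * (2 * exp 1 * R powr R))"
    by (intro mult_left_mono *) auto
  finally show ?thesis by (simp add: A_def algebra_simps)
qed

text \<open>The factor 2^R comes from bounding the modulus by twice the larger of the real and
  imaginary parts; the rest is the real constant 2 e R^R, once for each part.\<close>

definition khintchine_const :: "real \<Rightarrow> real" where
  "khintchine_const R = 2 powr R * 4 * exp 1 * R powr R"

lemma khintchine_upper:
  fixes a :: "nat \<Rightarrow> complex"
  assumes "R > 0"
  shows "(\<Sum>\<sigma>\<in>sign_vectors n. cmod (\<Sum>i<n. \<sigma> i *\<^sub>R a i) powr R)
    \<le> 2 ^ n * khintchine_const R * (\<Sum>i<n. (cmod (a i))\<^sup>2) powr (R / 2)"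
proof -
  let ?A = "\<Sum>i<n. (cmod (a i))\<^sup>2" and ?K = "2 ^ n * (2 * exp 1 * R powr R)"
  have "cmod w powr R \<le> 2 powr R * (\<bar>Re w\<bar> powr R + \<bar>Im w\<bar> powr R)" for w
  proof -
    have "cmod w \<le> 2 * max \<bar>Re w\<bar> \<bar>Im w\<bar>" using cmod_le[of w] by linarith
    then have "cmod w powr R \<le> (2 * max \<bar>Re w\<bar> \<bar>Im w\<bar>) powr R"
      using assms by (intro powr_mono2) auto
    also have "\<dots> = 2 powr R * max \<bar>Re w\<bar> \<bar>Im w\<bar> powr R" by (simp add: powr_mult)
    also have "\<dots> \<le> 2 powr R * (\<bar>Re w\<bar> powr R + \<bar>Im w\<bar> powr R)"
      by (intro mult_left_mono) (auto simp: max_def)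
    finally show ?thesis .
  qed
  then have "(\<Sum>\<sigma>\<in>sign_vectors n. cmod (\<Sum>i<n. \<sigma> i *\<^sub>R a i) powr R)
    \<le> (\<Sum>\<sigma>\<in>sign_vectors n. 2 powr R * (\<bar>\<Sum>i<n. \<sigma> i * Re (a i)\<bar> powr R
                                     + \<bar>\<Sum>i<n. \<sigma> i * Im (a i)\<bar> powr R))"
    by (intro sum_mono order_trans[OF \<open>\<And>w. cmod w powr R \<le> _ w\<close>]) simp
  also have "\<dots> = 2 powr R * ((\<Sum>\<sigma>\<in>sign_vectors n. \<bar>\<Sum>i<n. \<sigma> i * Re (a i)\<bar> powr R)
      + (\<Sum>\<sigma>\<in>sign_vectors n. \<bar>\<Sum>i<n. \<sigma> i * Im (a i)\<bar> powr R))"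
    by (simp add: sum_distrib_left sum.distrib distrib_left)
  also have "\<dots> \<le> 2 powr R * (?K * ?A powr (R / 2) + ?K * ?A powr (R / 2))"
    using assms
    by (intro mult_left_mono add_mono order_trans[OF khintchine_upper_real] powr_mono2 sum_mono sum_nonneg)
       (auto simp: cmod_def)
  finally show ?thesis by (simp add: khintchine_const_def algebra_simps)
qed

text \<open>Orthonormality of the signs, obtained from the parallelogram law applied to the last
  one.\<close>

lemma sum_sign_vectors_cmod_square:
  "(\<Sum>\<sigma>\<in>sign_vectors n. (cmod (\<Sum>i<n. \<sigma> i *\<^sub>R a i))\<^sup>2) = 2 ^ n * (\<Sum>i<n. (cmod (a i))\<^sup>2)"
proof (induction n)
  case (Suc n)
  have par: "(cmod (u + v))\<^sup>2 + (cmod (u - v))\<^sup>2 = 2 * (cmod u)\<^sup>2 + 2 * (cmod v)\<^sup>2" for u v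
    by (simp add: cmod_power2) (simp add: power2_eq_square algebra_simps)
  have "(\<Sum>\<sigma>\<in>sign_vectors (Suc n). (cmod (\<Sum>i<Suc n. \<sigma> i *\<^sub>R a i))\<^sup>2) =
      (\<Sum>\<sigma>\<in>sign_vectors n. (cmod ((\<Sum>i<n. \<sigma> i *\<^sub>R a i) + a n))\<^sup>2
        + (cmod ((\<Sum>i<n. \<sigma> i *\<^sub>R a i) - a n))\<^sup>2)"
    by (simp add: sum_sign_vectors_Suc)
  also have "\<dots> = 2 * (\<Sum>\<sigma>\<in>sign_vectors n. (cmod (\<Sum>i<n. \<sigma> i *\<^sub>R a i))\<^sup>2)
      + 2 ^ n * (2 * (cmod (a n))\<^sup>2)"
    by (simp add: par sum.distrib sum_distrib_left card_sign_vectors)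
  finally show ?case using Suc by (simp add: algebra_simps)
qed simp

text \<open>Jensen's inequality with a worse constant: since \<open>p \<ge> 2\<close>, once the square sum is
  normalised to \<open>1\<close> one has \<open>t\<^sup>2 \<le> 1/2 + c t\<^sup>p\<close>.\<close>
lemma khintchine_lower:
  fixes a :: "nat \<Rightarrow> complex"
  assumes "p \<ge> 2"
  shows "2 ^ n * (\<Sum>i<n. (cmod (a i))\<^sup>2) powr (p / 2)
    \<le> 2 powr (p / 2) * (\<Sum>\<sigma>\<in>sign_vectors n. cmod (\<Sum>i<n. \<sigma> i *\<^sub>R a i) powr p)"
proof (cases "(\<Sum>i<n. (cmod (a i))\<^sup>2) = 0")
  case False
  define A where "A = (\<Sum>i<n. (cmod (a i))\<^sup>2)"
  have "A \<ge> 0" unfolding A_def by (intro sum_nonneg) auto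
  with False have A: "A > 0" by (simp add: A_def)
  have *: "t\<^sup>2 \<le> A / 2 + (A / 2) powr (1 - p / 2) * t powr p" if t: "t \<ge> 0" for t :: real
  proof (cases "t\<^sup>2 \<le> A / 2")
    case True
    then show ?thesis by (simp add: add_increasing2)
  next
    case False
    then have t0: "t > 0" using t A by (cases "t = 0") auto
    \<comment> \<open>The exponent 1 - p/2 is at most 0, so t^2 > A/2 bounds the first factor from
      above.\<close>
    have "t\<^sup>2 = (t\<^sup>2) powr (1 - p / 2) * t powr p"
      using t0 by (simp add: powr_numeral[symmetric] powr_powr powr_add[symmetric] right_diff_distrib
          del: powr_numeral)
    also have "\<dots> \<le> (A / 2) powr (1 - p / 2) * t powr p"
      using False A assms by (intro mult_right_mono powr_mono2') auto
    finally show ?thesis using A by linarith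
  qed
  let ?S = "\<Sum>\<sigma>\<in>sign_vectors n. cmod (\<Sum>i<n. \<sigma> i *\<^sub>R a i) powr p"
  have "2 ^ n * A = (\<Sum>\<sigma>\<in>sign_vectors n. (cmod (\<Sum>i<n. \<sigma> i *\<^sub>R a i))\<^sup>2)"
    by (simp add: sum_sign_vectors_cmod_square A_def)
  also have "\<dots> \<le> (\<Sum>\<sigma>\<in>sign_vectors n. A / 2
      + (A / 2) powr (1 - p / 2) * cmod (\<Sum>i<n. \<sigma> i *\<^sub>R a i) powr p)"
    by (intro sum_mono *) auto
  also have "\<dots> = 2 ^ n * (A / 2) + (A / 2) powr (1 - p / 2) * ?S"
    by (simp add: sum.distrib sum_distrib_left card_sign_vectors)
  \<comment> \<open>The terms A/2 use up only half of the second moment.\<close>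
  finally have "2 ^ n * (A / 2) \<le> (A / 2) powr (1 - p / 2) * ?S" by simp
  then have "(A / 2) powr (p / 2 - 1) * (2 ^ n * (A / 2)) 
      \<le> (A / 2) powr (p / 2 - 1) * ((A / 2) powr (1 - p / 2) * ?S)"
    by (intro mult_left_mono) auto
  also have "\<dots> = ?S" using A by (simp add: powr_add[symmetric] mult.assoc[symmetric])
  also have "(A / 2) powr (p / 2 - 1) * (2 ^ n * (A / 2)) = 2 ^ n * (A / 2) powr (p / 2)"
    using A by (simp add: powr_diff)
  finally show ?thesis using A by (simp add: A_def[symmetric] powr_divide field_simps)
qed (use assms in \<open>simp add: sum_nonneg\<close>)

section \<open>Averages over Rademacher variables\<close>

lemma prob_rademacher_sign_vector:
  assumes "rademacher_sequence P \<epsilon>" and \<sigma>: "\<sigma> \<in> sign_vectors n"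
  shows "measure P {\<omega>\<in>space P. \<forall>i<n. \<epsilon> i \<omega> = \<sigma> i} = 1 / 2 ^ n"
proof -
  from assms interpret prob_space P by (simp add: rademacher_sequence_def)
  have ind: "indep_vars (\<lambda>_. borel) \<epsilon> UNIV"
    and half: "\<And>i. prob {\<omega>\<in>space P. \<epsilon> i \<omega> = 1} = 1 / 2" "\<And>i. prob {\<omega>\<in>space P. \<epsilon> i \<omega> = -1} = 1 / 2"
    using assms by (simp_all add: rademacher_sequence_def)
  show ?thesis
  \<comment> \<open>An empty intersection is \<open>UNIV\<close> rather than \<open>space P\<close>,
    so the case without signs stands apart.\<close>
  proof (cases "n = 0")
    case True
    then show ?thesis by (simp add: prob_space)
  next
    case False
    have "prob (\<Inter>i\<in>{..<n}. \<epsilon> i -` {\<sigma> i} \<inter> space P) = (\<Prod>i<n. prob (\<epsilon> i -` {\<sigma> i} \<inter> space P))"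
      using False by (intro indep_varsD[OF ind]) auto
    also have "\<dots> = (\<Prod>i<n. 1 / 2)"
    proof (intro prod.cong refl)
      fix i assume i: "i \<in> {..<n}"
      then have "\<sigma> i = 1 \<or> \<sigma> i = -1" using PiE_mem[OF \<sigma> i] by auto
      moreover have "\<epsilon> i -` {s} \<inter> space P = {\<omega>\<in>space P. \<epsilon> i \<omega> = s}" for s by auto
      ultimately show "prob (\<epsilon> i -` {\<sigma> i} \<inter> space P) = 1 / 2" using half by auto
    qed
    also have "(\<Inter>i\<in>{..<n}. \<epsilon> i -` {\<sigma> i} \<inter> space P) = {\<omega>\<in>space P. \<forall>i<n. \<epsilon> i \<omega> = \<sigma> i}"
      using False by auto
    finally show ?thesis by (simp add: power_divide)
  qed
qed

text \<open>Almost surely the first \<open>n\<close> variables form exactly one sign vector, so the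
  integrand agrees almost everywhere with a finite combination of indicators. This takes the place
  of a measurability argument for \<open>\<phi>\<close>. The restriction matches the extensionality
  of the elements of \<open>sign_vectors n\<close>.\<close>

lemma nn_integral_rademacher:
  fixes \<phi> :: "(nat \<Rightarrow> real) \<Rightarrow> ennreal"
  assumes R: "rademacher_sequence P \<epsilon>"
  shows "(\<integral>\<^sup>+\<omega>. \<phi> (restrict (\<lambda>i. \<epsilon> i \<omega>) {..<n}) \<partial>P) = (\<Sum>\<sigma>\<in>sign_vectors n. \<phi> \<sigma> * ennreal (1 / 2 ^ n))"
proof -
  from R interpret prob_space P by (simp add: rademacher_sequence_def)
  have ind: "indep_vars (\<lambda>_. borel) \<epsilon> UNIV"
    and half: "\<And>i. prob {\<omega>\<in>space P. \<epsilon> i \<omega> = 1} = 1 / 2" "\<And>i. prob {\<omega>\<in>space P. \<epsilon> i \<omega> = -1} = 1 / 2"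
    using R by (simp_all add: rademacher_sequence_def)
  have [measurable]: "\<epsilon> i \<in> borel_measurable P" for i
    using ind by (auto simp: indep_vars_def)
  define E where "E \<sigma> = {\<omega>\<in>space P. \<forall>i<n. \<epsilon> i \<omega> = \<sigma> i}" for \<sigma>
  have [measurable]: "E \<sigma> \<in> events" for \<sigma> unfolding E_def by measurable
  \<comment> \<open>Only the probabilities of the two values are prescribed; as they add up to 1,
    all other values have probability 0.\<close>
  have "AE \<omega> in P. \<epsilon> i \<omega> = 1 \<or> \<epsilon> i \<omega> = -1" for i
  proof -
    have "prob ({\<omega>\<in>space P. \<epsilon> i \<omega> = 1} \<union> {\<omega>\<in>space P. \<epsilon> i \<omega> = -1}) = 1 / 2 + 1 / 2"
      by (subst finite_measure_Union) (auto simp: half)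
    then have "prob {\<omega>\<in>space P. \<epsilon> i \<omega> = 1 \<or> \<epsilon> i \<omega> = -1} = 1"
      by (simp add: Collect_conj_eq[symmetric] Un_def) (metis (no_types, lifting) Collect_cong)
    then show ?thesis by (subst (asm) prob_Collect_eq_1) auto
  qed
  then have "AE \<omega> in P. \<forall>i. \<epsilon> i \<omega> = 1 \<or> \<epsilon> i \<omega> = -1" by (simp add: AE_all_countable)
  then have "AE \<omega> in P. \<phi> (restrict (\<lambda>i. \<epsilon> i \<omega>) {..<n})
      = (\<Sum>\<sigma>\<in>sign_vectors n. \<phi> \<sigma> * indicator (E \<sigma>) \<omega>)"
  proof (rule AE_mp, intro AE_I2 impI)
    fix \<omega> assume \<omega>: "\<omega> \<in> space P" "\<forall>i. \<epsilon> i \<omega> = 1 \<or> \<epsilon> i \<omega> = -1"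
    let ?\<sigma> = "restrict (\<lambda>i. \<epsilon> i \<omega>) {..<n}"
    have mem: "?\<sigma> \<in> sign_vectors n" using \<omega>(2) by auto
    have "indicator (E \<sigma>) \<omega> = (if \<sigma> = ?\<sigma> then 1 else 0 :: ennreal)" if "\<sigma> \<in> sign_vectors n" for \<sigma>
    proof -
      have "\<omega> \<in> E \<sigma> \<longleftrightarrow> \<sigma> = ?\<sigma>"
        using \<omega>(1) that by (auto simp: E_def PiE_iff extensional_def fun_eq_iff restrict_def)
      then show ?thesis by auto
    qed
    then have "(\<Sum>\<sigma>\<in>sign_vectors n. \<phi> \<sigma> * indicator (E \<sigma>) \<omega>)
        = (\<Sum>\<sigma>\<in>sign_vectors n. if \<sigma> = ?\<sigma> then \<phi> \<sigma> else 0)"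
      by (intro sum.cong) auto
    also have "\<dots> = \<phi> ?\<sigma>" using mem by (simp add: finite_sign_vectors)
    finally show "\<phi> ?\<sigma> = (\<Sum>\<sigma>\<in>sign_vectors n. \<phi> \<sigma> * indicator (E \<sigma>) \<omega>)" by simp
  qed
  then have "(\<integral>\<^sup>+\<omega>. \<phi> (restrict (\<lambda>i. \<epsilon> i \<omega>) {..<n}) \<partial>P)
      = (\<integral>\<^sup>+\<omega>. (\<Sum>\<sigma>\<in>sign_vectors n. \<phi> \<sigma> * indicator (E \<sigma>) \<omega>) \<partial>P)"
    by (rule nn_integral_cong_AE)
  also have "\<dots> = (\<Sum>\<sigma>\<in>sign_vectors n. \<phi> \<sigma> * emeasure P (E \<sigma>))"
    by (simp add: nn_integral_sum nn_integral_cmult_indicator)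
  also have "\<dots> = (\<Sum>\<sigma>\<in>sign_vectors n. \<phi> \<sigma> * ennreal (1 / 2 ^ n))"
    by (intro sum.cong refl)
       (simp add: emeasure_eq_measure E_def prob_rademacher_sign_vector[OF R])
  finally show ?thesis .
qed

text \<open>The comparison \<open>E Y\<^sup>l \<le> D H\<^sup>l\<close> for all \<open>l\<close> together with \<open>H \<le> c E Y\<close> yields
  \<open>E Y\<^sup>\<alpha> \<approx> H\<^sup>\<alpha>\<close> for each \<open>\<alpha> > 0\<close>; this is how Kahane's inequality enters.\<close>

lemma average_powr_le:
  fixes Y :: "'s \<Rightarrow> real" and H D :: real
  assumes "finite S" "\<And>s. s \<in> S \<Longrightarrow> Y s \<ge> 0" "H > 0" "0 < \<alpha>" "\<alpha> \<le> real l"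
    and "(\<Sum>s\<in>S. Y s ^ l) \<le> card S * D * H ^ l"
  shows "(\<Sum>s\<in>S. Y s powr \<alpha>) \<le> card S * (1 + D) * H powr \<alpha>"
proof -
  have l: "l > 0" using assms(4,5) by (cases l) auto
  have *: "Y s powr \<alpha> \<le> H powr \<alpha> * (1 + (Y s / H) ^ l)" if s: "s \<in> S" for s
  proof -
    have "(Y s / H) powr \<alpha> \<le> 1 + (Y s / H) ^ l"
    proof (cases "Y s / H \<le> 1")
      case True
      have "(Y s / H) powr \<alpha> \<le> 1 powr \<alpha>"
        using assms True s by (intro powr_mono2) auto
      then show ?thesis using assms(2)[OF s] assms(3) by (simp add: add_increasing2)
    next
      case False
      then have "(Y s / H) powr \<alpha> \<le> (Y s / H) powr (real l)"
        using assms by (intro powr_mono) auto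
      also have "\<dots> = (Y s / H) ^ l" using False by (intro powr_realpow) auto
      finally show ?thesis by simp
    qed
    then have "H powr \<alpha> * (Y s / H) powr \<alpha> \<le> H powr \<alpha> * (1 + (Y s / H) ^ l)"
      by (intro mult_left_mono) auto
    then show ?thesis using assms(2)[OF s] assms(3) by (simp add: powr_divide)
  qed
  have "(\<Sum>s\<in>S. Y s powr \<alpha>) \<le> (\<Sum>s\<in>S. H powr \<alpha> * (1 + (Y s / H) ^ l))"
    by (intro sum_mono *)
  also have "\<dots> = H powr \<alpha> * (card S + (\<Sum>s\<in>S. Y s ^ l) / H ^ l)"
    by (simp add: sum_distrib_left[symmetric] sum.distrib power_divide sum_divide_distrib)
  also have "\<dots> \<le> H powr \<alpha> * (card S + card S * D)"
    using assms by (intro mult_left_mono add_left_mono) (auto simp: field_simps)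
  finally show ?thesis by (simp add: algebra_simps)
qed

text \<open>An argument of Paley-Zygmund type: the second moment prevents the first from living on
  large values. \<open>K\<close> is chosen before \<open>S\<close>, \<open>Y\<close> and
  \<open>H\<close>, which later makes the constant independent of the number of signs.\<close>

lemma average_powr_ge:
  fixes \<alpha> c D :: real
  assumes "0 < \<alpha>" "0 < c" "0 < D"
  shows "\<exists>K\<ge>0. \<forall>(S :: 's set) Y (H::real). finite S \<longrightarrow> (\<forall>s\<in>S. Y s \<ge> 0) \<longrightarrow> H > 0 \<longrightarrow>
      card S * H \<le> c * (\<Sum>s\<in>S. Y s) \<longrightarrow> (\<Sum>s\<in>S. (Y s)\<^sup>2) \<le> card S * D * H\<^sup>2 \<longrightarrow>
      card S * H powr \<alpha> \<le> K * (\<Sum>s\<in>S. Y s powr \<alpha>)"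
proof -
  \<comment> \<open>Both c u and c D / v equal 1/4, so values of Y/H below u or above v account for
    at most half of the lower bound on the first moment.\<close>
  define u v where "u = 1 / (4 * c)" and "v = 4 * c * D"
  \<comment> \<open>A bound for t^(1-\<alpha>) between u and v; with both endpoint values it covers
    either sign of the exponent.\<close>
  define k where "k = u powr (1 - \<alpha>) + v powr (1 - \<alpha>)"
  have uv: "u > 0" "v > 0" using assms by (auto simp: u_def v_def)
  have k: "k \<ge> 0" by (simp add: k_def)
  have pt: "t \<le> u + t\<^sup>2 / v + k * t powr \<alpha>" if "t \<ge> 0" for t
  proof -
    consider "t \<le> u" | "t \<ge> v" | "u < t" "t < v" by linarith
    then show ?thesis
    proof cases
      case 1
      have "t\<^sup>2 / v + k * t powr \<alpha> \<ge> 0" using uv k by simp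
      then show ?thesis using 1 by linarith
    next
      case 2
      then have "t \<le> t\<^sup>2 / v" using uv that by (simp add: field_simps power2_eq_square mult_left_mono)
      moreover have "u + k * t powr \<alpha> \<ge> 0" using uv k by simp
      ultimately show ?thesis by linarith
    next
      case 3
      have "t = t powr (1 - \<alpha>) * t powr \<alpha>" using 3 uv by (simp add: powr_add[symmetric])
      also have "t powr (1 - \<alpha>) \<le> k"
      proof (cases "\<alpha> \<le> 1")
        case True
        then have "t powr (1 - \<alpha>) \<le> v powr (1 - \<alpha>)" using 3 uv by (intro powr_mono2) auto
        then show ?thesis by (simp add: k_def add_increasing)
      next
        case False
        then have "t powr (1 - \<alpha>) \<le> u powr (1 - \<alpha>)" using 3 uv by (intro powr_mono2') auto
        then show ?thesis by (simp add: k_def add_increasing2)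
      qed
      then have "t powr (1 - \<alpha>) * t powr \<alpha> \<le> k * t powr \<alpha>" by (intro mult_right_mono) auto
      finally have "t \<le> k * t powr \<alpha>" .
      moreover have "u + t\<^sup>2 / v \<ge> 0" using uv by simp
      ultimately show ?thesis by linarith
    qed
  qed
  have main: "card S * H powr \<alpha> \<le> (2 * c * k) * (\<Sum>s\<in>S. Y s powr \<alpha>)"
    if S: "finite S" "\<forall>s\<in>S. Y s \<ge> 0" "H > 0" and
       le: "card S * H \<le> c * (\<Sum>s\<in>S. Y s)" "(\<Sum>s\<in>S. (Y s)\<^sup>2) \<le> card S * D * H\<^sup>2"
    for S :: "'s set" and Y and H :: real
  proof -
    let ?N = "real (card S)"
    have "?N \<le> c * (\<Sum>s\<in>S. Y s / H)"
      using le(1) S(3) by (simp add: sum_divide_distrib[symmetric] field_simps)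
    also have "(\<Sum>s\<in>S. Y s / H) \<le> (\<Sum>s\<in>S. u + (Y s / H)\<^sup>2 / v + k * (Y s / H) powr \<alpha>)"
      using S by (intro sum_mono pt) auto
    also have "\<dots> = ?N * u + (\<Sum>s\<in>S. (Y s)\<^sup>2) / H\<^sup>2 / v + k * (\<Sum>s\<in>S. Y s powr \<alpha>) / H powr \<alpha>"
      using S by (simp add: sum.distrib sum_divide_distrib[symmetric] sum_distrib_left[symmetric]
          power_divide powr_divide)
    also have "(\<Sum>s\<in>S. (Y s)\<^sup>2) / H\<^sup>2 / v \<le> ?N * D / v"
      using le(2) S(3) uv by (intro divide_right_mono) (auto simp: field_simps)
    finally have "?N \<le> c * (?N * u + ?N * D / v + k * (\<Sum>s\<in>S. Y s powr \<alpha>) / H powr \<alpha>)"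
      using assms by simp
    also have "\<dots> = ?N / 2 + c * k * (\<Sum>s\<in>S. Y s powr \<alpha>) / H powr \<alpha>"
      using assms by (simp add: u_def v_def field_simps)
    finally have "?N \<le> 2 * (c * k * (\<Sum>s\<in>S. Y s powr \<alpha>) / H powr \<alpha>)" by simp
    then show ?thesis using S(3) by (simp add: field_simps)
  qed
  show ?thesis
    using main k assms by (intro exI[of _ "2 * c * k"]) auto
qed

section \<open>The Kahane--Khintchine inequality in \<open>L\<^sup>p\<close>\<close>

text \<open>Bounds the sum by \<open>n\<close> times its largest term. The dependence on
  \<open>n\<close> is harmless, since the bound serves only to establish integrability.\<close>

lemma sum_powr_le:
  fixes t :: "nat \<Rightarrow> real"
  assumes "q > 0" "\<And>i. i < n \<Longrightarrow> t i \<ge> 0"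
  shows "(\<Sum>i<n. t i) powr q \<le> real n powr q * (\<Sum>i<n. t i powr q)"
proof (cases "n = 0")
  case False
  then have "Max (t ` {..<n}) \<in> t ` {..<n}" by (intro Max_in) auto
  then obtain j where j: "j < n" "t j = Max (t ` {..<n})" by auto
  have "(\<Sum>i<n. t i) \<le> (\<Sum>i<n. t j)" unfolding j(2) by (intro sum_mono Max_ge) auto
  then have "(\<Sum>i<n. t i) powr q \<le> (real n * t j) powr q"
    using assms by (intro powr_mono2 sum_nonneg) auto
  also have "\<dots> = real n powr q * t j powr q" using assms j by (simp add: powr_mult)
  also have "t j powr q \<le> (\<Sum>i<n. t i powr q)"
    using j by (intro member_le_sum) auto
  finally show ?thesis by (simp add: mult_left_mono)
qed simp

text \<open>The p-th power of the L^p norm of the square function. Without the root, averages over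
  signs can be exchanged with the integral.\<close>

definition square_fun_integral :: "'a measure \<Rightarrow> real \<Rightarrow> nat \<Rightarrow> (nat \<Rightarrow> 'a \<Rightarrow> complex) \<Rightarrow> real" where
  "square_fun_integral M p n f = (\<integral>x. (\<Sum>i<n. (cmod (f i x))\<^sup>2) powr (p / 2) \<partial>M)"

definition signed_sum_integral ::
    "'a measure \<Rightarrow> real \<Rightarrow> nat \<Rightarrow> (nat \<Rightarrow> 'a \<Rightarrow> complex) \<Rightarrow> (nat \<Rightarrow> real) \<Rightarrow> real" where
  "signed_sum_integral M p n f \<sigma> = (\<integral>x. cmod (\<Sum>i<n. \<sigma> i *\<^sub>R f i x) powr p \<partial>M)"

context
  fixes M :: "'a measure" and p :: real and n :: nat and f :: "nat \<Rightarrow> 'a \<Rightarrow> complex"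
  assumes p: "p > 0"
    and f_meas: "\<And>i. i < n \<Longrightarrow> f i \<in> borel_measurable M"
    and f_int: "\<And>i. i < n \<Longrightarrow> integrable M (\<lambda>x. cmod (f i x) powr p)"
begin

lemma measurable_signed_sum: "(\<lambda>x. \<Sum>i<n. (\<sigma> i :: real) *\<^sub>R f i x) \<in> borel_measurable M"
  using f_meas by (intro borel_measurable_sum borel_measurable_scaleR) auto

lemma measurable_square_sum: "(\<lambda>x. \<Sum>i<n. (cmod (f i x))\<^sup>2) \<in> borel_measurable M"
  using f_meas by (intro borel_measurable_sum borel_measurable_power) auto

lemma integrable_signed_sum_powr:
  "integrable M (\<lambda>x. cmod (\<Sum>i<n. \<sigma> i *\<^sub>R f i x) powr p)"
proof (rule Bochner_Integration.integrable_bound)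
  show "integrable M (\<lambda>x. real n powr p * (\<Sum>i<n. \<bar>\<sigma> i\<bar> powr p * cmod (f i x) powr p))"
    using f_int by (intro integrable_mult_right Bochner_Integration.integrable_sum) auto
  show "(\<lambda>x. cmod (\<Sum>i<n. \<sigma> i *\<^sub>R f i x) powr p) \<in> borel_measurable M"
    using measurable_signed_sum by measurable
  show "AE x in M. norm (cmod (\<Sum>i<n. \<sigma> i *\<^sub>R f i x) powr p)
      \<le> norm (real n powr p * (\<Sum>i<n. \<bar>\<sigma> i\<bar> powr p * cmod (f i x) powr p))"
  proof (rule AE_I2)
    fix x
    have "cmod (\<Sum>i<n. \<sigma> i *\<^sub>R f i x) powr p \<le> (\<Sum>i<n. \<bar>\<sigma> i\<bar> * cmod (f i x)) powr p"
      using p by (intro powr_mono2 order_trans[OF norm_sum]) (auto intro!: sum_mono)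
    also have "\<dots> \<le> real n powr p * (\<Sum>i<n. (\<bar>\<sigma> i\<bar> * cmod (f i x)) powr p)"
      using p by (intro sum_powr_le) auto
    finally show "norm (cmod (\<Sum>i<n. \<sigma> i *\<^sub>R f i x) powr p)
      \<le> norm (real n powr p * (\<Sum>i<n. \<bar>\<sigma> i\<bar> powr p * cmod (f i x) powr p))"
      by (simp add: powr_mult sum_nonneg)
  qed
qed

lemma integrable_square_fun:
  "integrable M (\<lambda>x. (\<Sum>i<n. (cmod (f i x))\<^sup>2) powr (p / 2))"
proof (rule Bochner_Integration.integrable_bound)
  show "integrable M (\<lambda>x. real n powr (p / 2) * (\<Sum>i<n. cmod (f i x) powr p))"
    using f_int by (intro integrable_mult_right Bochner_Integration.integrable_sum) auto
  show "(\<lambda>x. (\<Sum>i<n. (cmod (f i x))\<^sup>2) powr (p / 2)) \<in> borel_measurable M"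
    using measurable_square_sum by measurable
  show "AE x in M. norm ((\<Sum>i<n. (cmod (f i x))\<^sup>2) powr (p / 2))
      \<le> norm (real n powr (p / 2) * (\<Sum>i<n. cmod (f i x) powr p))"
  proof (rule AE_I2)
    fix x
    have "((cmod z)\<^sup>2) powr (p / 2) = cmod z powr p" for z
      by (cases "z = 0") (simp_all add: powr_numeral[symmetric] powr_powr del: powr_numeral)
    then show "norm ((\<Sum>i<n. (cmod (f i x))\<^sup>2) powr (p / 2))
      \<le> norm (real n powr (p / 2) * (\<Sum>i<n. cmod (f i x) powr p))"
      using sum_powr_le[of "p / 2" n "\<lambda>i. (cmod (f i x))\<^sup>2"] p by (simp add: sum_nonneg)
  qed
qed

lemma signed_sum_integral_nonneg: "signed_sum_integral M p n f \<sigma> \<ge> 0"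
  unfolding signed_sum_integral_def by (intro integral_nonneg_AE) auto

lemma square_fun_integral_nonneg: "square_fun_integral M p n f \<ge> 0"
  unfolding square_fun_integral_def by (intro integral_nonneg_AE) auto

text \<open>Disposes of the degenerate case in which one cannot divide by the square function
  integral.\<close>

lemma signed_sum_integral_eq_0:
  assumes "square_fun_integral M p n f = 0"
  shows "signed_sum_integral M p n f \<sigma> = 0"
proof -
  have "AE x in M. (\<Sum>i<n. (cmod (f i x))\<^sup>2) powr (p / 2) = 0"
    using assms integrable_square_fun unfolding square_fun_integral_def
    by (subst (asm) integral_nonneg_eq_0_iff_AE) auto
  then have "AE x in M. cmod (\<Sum>i<n. \<sigma> i *\<^sub>R f i x) powr p = 0"
  proof (rule AE_mp, intro AE_I2 impI)
    fix x assume "(\<Sum>i<n. (cmod (f i x))\<^sup>2) powr (p / 2) = 0"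
    then have "(\<Sum>i<n. (cmod (f i x))\<^sup>2) = 0" by simp
    then have "\<forall>i<n. f i x = 0" by (subst (asm) sum_nonneg_eq_0_iff) auto
    then show "cmod (\<Sum>i<n. \<sigma> i *\<^sub>R f i x) powr p = 0" by simp
  qed
  then show ?thesis unfolding signed_sum_integral_def by (rule integral_eq_zero_AE)
qed

text \<open>Jensen's inequality for the measure with density \<open>v\<close>, applied to \<open>|F|\<^sup>p / v\<close>, where \<open>v\<close> is the
  \<open>p\<close>-th power of the square function; it reduces the claim to the scalar inequality with
  exponent \<open>p l\<close>.\<close>
lemma sum_signed_sum_integral_power_le:
  assumes l: "l > 0"
  shows "(\<Sum>\<sigma>\<in>sign_vectors n. signed_sum_integral M p n f \<sigma> ^ l)
    \<le> 2 ^ n * khintchine_const (p * l) * square_fun_integral M p n f ^ l"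
proof (cases "square_fun_integral M p n f = 0")
  case True
  then show ?thesis by (simp add: signed_sum_integral_eq_0 zero_power[OF l])
next
  case False
  define H where "H = square_fun_integral M p n f"
  have H: "H > 0" using False square_fun_integral_nonneg by (simp add: H_def)
  define A where "A x = (\<Sum>i<n. (cmod (f i x))\<^sup>2)" for x
  define v where "v x = A x powr (p / 2)" for x
  define w where "w \<sigma> x = cmod (\<Sum>i<n. \<sigma> i *\<^sub>R f i x) powr p" for \<sigma> x
  \<comment> \<open>The l-th power of the density of \<open>w \<sigma>\<close> relative to
    \<open>v\<close>, integrated against \<open>v\<close>. Where \<open>v\<close> vanishes so does
    \<open>w \<sigma>\<close>, so the default value of division by zero is the right one.\<close>
  define G where "G \<sigma> x = (w \<sigma> x / v x) ^ l * v x" for \<sigma> x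
  define D where "D = 2 ^ n * khintchine_const (p * l)"
  have A0: "A x \<ge> 0" for x by (simp add: A_def sum_nonneg)
  have v0: "v x \<ge> 0" and w0: "w \<sigma> x \<ge> 0" for \<sigma> x by (simp_all add: v_def w_def)
  have w_0: "w \<sigma> x = 0" if "v x = 0" for \<sigma> x
  proof -
    have "(\<Sum>i<n. (cmod (f i x))\<^sup>2) = 0" using that by (simp add: v_def A_def)
    then have "\<forall>i<n. f i x = 0" by (subst (asm) sum_nonneg_eq_0_iff) auto
    then show ?thesis by (simp add: w_def)
  qed
  have v_int: "integrable M v" unfolding v_def A_def by (rule integrable_square_fun)
  have w_int: "integrable M (w \<sigma>)" for \<sigma> unfolding w_def by (rule integrable_signed_sum_powr)
  have Hv: "H = (\<integral>x. v x \<partial>M)" by (simp add: H_def v_def A_def square_fun_integral_def)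
  have Yw: "signed_sum_integral M p n f \<sigma> = (\<integral>x. w \<sigma> x \<partial>M)" for \<sigma>
    by (simp add: w_def signed_sum_integral_def)
  have sumG: "(\<Sum>\<sigma>\<in>sign_vectors n. G \<sigma> x) \<le> D * v x" for x
  proof (cases "v x = 0")
    case True
    then show ?thesis by (simp add: G_def)
  next
    case False
    then have vx: "v x > 0" using v0[of x] by simp
    have pow: "(t powr p) ^ l = t powr (p * l)" for t :: real
      using powr_power[of t p l] l by (cases "t = 0") (simp_all add: mult.commute)
    have "(\<Sum>\<sigma>\<in>sign_vectors n. w \<sigma> x ^ l) \<le> D * A x powr (p * l / 2)"
      unfolding w_def pow D_def A_def using l p by (intro khintchine_upper) simp
    also have "A x powr (p * l / 2) = v x ^ l"
      using vx by (simp add: powr_realpow[symmetric]) (simp add: v_def powr_powr)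
    finally have "(\<Sum>\<sigma>\<in>sign_vectors n. w \<sigma> x ^ l) \<le> D * v x ^ l" .
    moreover have "(\<Sum>\<sigma>\<in>sign_vectors n. G \<sigma> x) = (\<Sum>\<sigma>\<in>sign_vectors n. w \<sigma> x ^ l) / v x ^ l * v x"
      by (simp add: G_def power_divide sum_divide_distrib sum_distrib_right)
    moreover have "\<dots> \<le> D * v x ^ l / v x ^ l * v x"
      using calculation(1) vx by (intro mult_right_mono divide_right_mono) auto
    ultimately show ?thesis using vx by simp
  qed
  have G0: "G \<sigma> x \<ge> 0" for \<sigma> x using v0 w0 by (simp add: G_def)
  have G_meas: "G \<sigma> \<in> borel_measurable M" for \<sigma>
    using v_int w_int unfolding G_def by (intro borel_measurable_times borel_measurable_power
      borel_measurable_divide borel_measurable_integrable)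
  have G_int: "integrable M (G \<sigma>)" if \<sigma>: "\<sigma> \<in> sign_vectors n" for \<sigma>
  proof (rule Bochner_Integration.integrable_bound)
    show "integrable M (\<lambda>x. D * v x)" using v_int by simp
    show "AE x in M. norm (G \<sigma> x) \<le> norm (D * v x)"
    proof (rule AE_I2)
      fix x
      have "G \<sigma> x \<le> (\<Sum>\<sigma>\<in>sign_vectors n. G \<sigma> x)"
        using \<sigma> G0 by (intro member_le_sum) (auto simp: finite_sign_vectors)
      with sumG[of x] G0[of \<sigma> x] show "norm (G \<sigma> x) \<le> norm (D * v x)" by simp
    qed
  qed (rule G_meas)
  have jensen: "(signed_sum_integral M p n f \<sigma> / H) ^ l * H \<le> (\<integral>x. G \<sigma> x \<partial>M)"
    if \<sigma>: "\<sigma> \<in> sign_vectors n" for \<sigma>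
  proof -
    define a where "a = signed_sum_integral M p n f \<sigma> / H"
    show ?thesis
    proof (cases "a = 0")
      case True
      moreover have "(\<integral>x. G \<sigma> x \<partial>M) \<ge> 0" by (intro integral_nonneg_AE) (simp add: G0)
      ultimately show ?thesis by (simp add: a_def[symmetric] zero_power[OF l])
    next
      case False
      then have a: "a > 0" using H signed_sum_integral_nonneg[of \<sigma>] by (simp add: a_def)
      \<comment> \<open>The tangent line of the l-th power at the mean \<open>a\<close>, supplied by
        Bernoulli's inequality. Its linear part integrates to 0, because the integral of
        \<open>w \<sigma>\<close> is \<open>a * H\<close>.\<close>
      have pt: "a ^ l * (v x + l * (w \<sigma> x / a - v x)) \<le> G \<sigma> x" for x
      proof (cases "v x = 0")
        case True
        then show ?thesis by (simp add: G_def w_0)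
      next
        case False
        then have vx: "v x > 0" using v0[of x] by simp
        define u where "u = w \<sigma> x / v x"
        have u: "u \<ge> 0" using vx w0 by (simp add: u_def)
        have "1 + l * (u / a - 1) \<le> (1 + (u / a - 1)) ^ l"
          using a u by (intro Bernoulli_inequality) simp
        then have "a ^ l * v x * (1 + l * (u / a - 1)) \<le> a ^ l * v x * (u / a) ^ l"
          using a vx by (intro mult_left_mono) auto
        moreover have "a ^ l * v x * (u / a) ^ l = G \<sigma> x"
          using a by (simp add: G_def u_def[symmetric] power_divide)
        moreover have "w \<sigma> x = u * v x" using vx by (simp add: u_def)
        ultimately show ?thesis by (simp add: algebra_simps)
      qed
      have "a ^ l * H = a ^ l * (H + l * ((\<integral>x. w \<sigma> x \<partial>M) / a - H))"
        using H a l by (simp add: a_def Yw)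
      also have "\<dots> = (\<integral>x. a ^ l * (v x + l * (w \<sigma> x / a - v x)) \<partial>M)"
        using v_int w_int by (simp add: Hv)
      also have "\<dots> \<le> (\<integral>x. G \<sigma> x \<partial>M)"
        using v_int w_int by (intro integral_mono pt G_int \<sigma>) auto
      finally show ?thesis by (simp add: a_def)
    qed
  qed
  have "(\<Sum>\<sigma>\<in>sign_vectors n. (signed_sum_integral M p n f \<sigma> / H) ^ l * H)
    \<le> (\<Sum>\<sigma>\<in>sign_vectors n. \<integral>x. G \<sigma> x \<partial>M)" by (intro sum_mono jensen)
  also have "\<dots> = (\<integral>x. (\<Sum>\<sigma>\<in>sign_vectors n. G \<sigma> x) \<partial>M)"
    by (rule Bochner_Integration.integral_sum[symmetric]) (rule G_int)
  also have "\<dots> \<le> (\<integral>x. D * v x \<partial>M)"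
    using v_int G_int by (intro integral_mono sumG Bochner_Integration.integrable_sum) auto
  also have "\<dots> = D * H" by (simp add: Hv)
  finally have "(\<Sum>\<sigma>\<in>sign_vectors n. (signed_sum_integral M p n f \<sigma> / H) ^ l) * H \<le> D * H"
    by (simp add: sum_distrib_right)
  then have "(\<Sum>\<sigma>\<in>sign_vectors n. (signed_sum_integral M p n f \<sigma>) ^ l) / H ^ l \<le> D"
    using H by (simp add: power_divide sum_divide_distrib)
  then show ?thesis using H by (simp add: D_def H_def[symmetric] field_simps)
qed

text \<open>Integrates \<open>khintchine_lower\<close> pointwise; this is the lower bound on the
  first moment that \<open>average_powr_ge\<close> asks for.\<close>

lemma square_fun_integral_le:
  assumes "p \<ge> 2"
  shows "2 ^ n * square_fun_integral M p n f
    \<le> 2 powr (p / 2) * (\<Sum>\<sigma>\<in>sign_vectors n. signed_sum_integral M p n f \<sigma>)"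
proof -
  have "2 ^ n * square_fun_integral M p n f
      = (\<integral>x. 2 ^ n * (\<Sum>i<n. (cmod (f i x))\<^sup>2) powr (p / 2) \<partial>M)"
    by (simp add: square_fun_integral_def)
  also have "\<dots> \<le> (\<integral>x. 2 powr (p / 2)
      * (\<Sum>\<sigma>\<in>sign_vectors n. cmod (\<Sum>i<n. \<sigma> i *\<^sub>R f i x) powr p) \<partial>M)"
    using assms integrable_square_fun integrable_signed_sum_powr
    by (intro integral_mono khintchine_lower integrable_mult_right Bochner_Integration.integrable_sum) auto
  also have "\<dots> = 2 powr (p / 2) * (\<Sum>\<sigma>\<in>sign_vectors n. signed_sum_integral M p n f \<sigma>)"
    using integrable_signed_sum_powr by (simp add: signed_sum_integral_def)
  finally show ?thesis .
qed

end

text \<open>\<open>K\<close> depends on \<open>p\<close> and \<open>\<alpha>\<close> only. The upper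
  estimate interpolates from a higher moment, the lower one from the first and second moments, so
  that \<alpha> < 1 is covered as well.\<close>

lemma kahane_khintchine:
  fixes p \<alpha> :: real
  assumes p: "p \<ge> 2" and \<alpha>: "\<alpha> > 0"
  shows "\<exists>K\<ge>0. \<forall>(M :: 'a measure) n f.
    (\<forall>i<n. f i \<in> borel_measurable M \<and> integrable M (\<lambda>x. cmod (f i x) powr p)) \<longrightarrow>
    (\<Sum>\<sigma>\<in>sign_vectors n. signed_sum_integral M p n f \<sigma> powr \<alpha>)
      \<le> 2 ^ n * K * square_fun_integral M p n f powr \<alpha> \<and>
    2 ^ n * square_fun_integral M p n f powr \<alpha>
      \<le> K * (\<Sum>\<sigma>\<in>sign_vectors n. signed_sum_integral M p n f \<sigma> powr \<alpha>)"
proof -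
  \<comment> \<open>Moments of the signed integrals are controlled for natural exponents, so
    \<alpha> is rounded up.\<close>
  define l where "l = nat \<lceil>\<alpha>\<rceil>"
  have l: "\<alpha> \<le> l" "l > 0" using \<alpha> unfolding l_def by linarith+
  define K1 where "K1 = 1 + khintchine_const (p * l)"
  have D: "khintchine_const R > 0" if "R > 0" for R
    using that by (simp add: khintchine_const_def)
  have "0 < 2 powr (p / 2)" "0 < khintchine_const (p * real 2)" using p D by auto
  from average_powr_ge[OF \<alpha> this, where 's = "nat \<Rightarrow> real"]
  obtain K2 where K2: "K2 \<ge> 0" "\<And>(S :: (nat \<Rightarrow> real) set) Y (H::real). finite S \<Longrightarrow> (\<forall>s\<in>S. Y s \<ge> 0) \<Longrightarrow>
      H > 0 \<Longrightarrow> card S * H \<le> 2 powr (p / 2) * (\<Sum>s\<in>S. Y s) \<Longrightarrow>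
      (\<Sum>s\<in>S. (Y s)\<^sup>2) \<le> card S * khintchine_const (p * real 2) * H\<^sup>2 \<Longrightarrow>
      card S * H powr \<alpha> \<le> K2 * (\<Sum>s\<in>S. Y s powr \<alpha>)" by metis
  have K1: "K1 \<ge> 0" using D[of "p * l"] p l by (simp add: K1_def)
  have "(\<Sum>\<sigma>\<in>sign_vectors n. signed_sum_integral M p n f \<sigma> powr \<alpha>)
      \<le> 2 ^ n * (K1 + K2) * square_fun_integral M p n f powr \<alpha> \<and>
    2 ^ n * square_fun_integral M p n f powr \<alpha>
      \<le> (K1 + K2) * (\<Sum>\<sigma>\<in>sign_vectors n. signed_sum_integral M p n f \<sigma> powr \<alpha>)"
    if f: "\<forall>i<n. f i \<in> borel_measurable M \<and> integrable M (\<lambda>x. cmod (f i x) powr p)"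
    for M :: "'a measure" and n f
  proof (cases "square_fun_integral M p n f = 0")
    case True
    have "signed_sum_integral M p n f \<sigma> = 0" for \<sigma>
      using p f True by (intro signed_sum_integral_eq_0) auto
    then show ?thesis using True by simp
  next
    case False
    let ?Y = "signed_sum_integral M p n f" and ?H = "square_fun_integral M p n f"
    have "?H \<ge> 0" by (simp add: square_fun_integral_def)
    with False have H: "?H > 0" by simp
    have Y: "?Y \<sigma> \<ge> 0" for \<sigma> by (simp add: signed_sum_integral_def)
    have mom: "(\<Sum>\<sigma>\<in>sign_vectors n. ?Y \<sigma> ^ j) \<le> 2 ^ n * khintchine_const (p * j) * ?H ^ j" if "j > 0" for j
      using p f that by (intro sum_signed_sum_integral_power_le) auto
    have "(\<Sum>\<sigma>\<in>sign_vectors n. ?Y \<sigma> powr \<alpha>) \<le> 2 ^ n * K1 * ?H powr \<alpha>"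
      using average_powr_le[OF finite_sign_vectors[of n] Y H \<alpha> l(1), where D = "khintchine_const (p * l)"] mom[OF l(2)]
      by (simp add: card_sign_vectors K1_def)
    also have "\<dots> \<le> 2 ^ n * (K1 + K2) * ?H powr \<alpha>"
      using K2(1) by (intro mult_right_mono mult_left_mono) auto
    finally have 1: "(\<Sum>\<sigma>\<in>sign_vectors n. ?Y \<sigma> powr \<alpha>) \<le> 2 ^ n * (K1 + K2) * ?H powr \<alpha>" .
    have "2 ^ n * ?H \<le> 2 powr (p / 2) * (\<Sum>\<sigma>\<in>sign_vectors n. ?Y \<sigma>)"
      using p f by (intro square_fun_integral_le) auto
    then have "2 ^ n * ?H powr \<alpha> \<le> K2 * (\<Sum>\<sigma>\<in>sign_vectors n. ?Y \<sigma> powr \<alpha>)"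
      using K2(2)[OF finite_sign_vectors[of n], of ?Y ?H] mom[of 2] H Y by (simp add: card_sign_vectors)
    also have "\<dots> \<le> (K1 + K2) * (\<Sum>\<sigma>\<in>sign_vectors n. ?Y \<sigma> powr \<alpha>)"
      using K1 by (intro mult_right_mono sum_nonneg) auto
    finally show ?thesis using 1 by blast
  qed
  then show ?thesis using K1 K2(1) by (intro exI[of _ "K1 + K2"]) auto
qed

section \<open>Weighted estimate for integral operators\<close>

lemma Lp_norm_ennreal:
  assumes "p > 0"
  shows "Lp_norm M (ennreal p) f =
    (let I = \<integral>\<^sup>+x. ennreal (norm (f x) powr p) \<partial>M
     in if I = \<infinity> then \<infinity> else ennreal (enn2real I powr (1 / p)))"
  using assms by (simp add: Lp_norm_def Let_def)

lemma Lp_space_iff: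
  assumes "p > 0"
  shows "f \<in> Lp_space M (ennreal p) \<longleftrightarrow>
    f \<in> borel_measurable M \<and> integrable M (\<lambda>x. cmod (f x) powr p)"
proof -
  have "Lp_norm M (ennreal p) f < \<infinity> \<longleftrightarrow> integrable M (\<lambda>x. cmod (f x) powr p)"
    if [measurable]: "f \<in> borel_measurable M"
    using assms by (auto simp: Lp_norm_ennreal Let_def integrable_iff_bounded less_top)
  then show ?thesis by (auto simp: Lp_space_def)
qed

lemma enn2real_Lp_norm:
  assumes "p > 0" "f \<in> Lp_space M (ennreal p)"
  shows "enn2real (Lp_norm M (ennreal p) f) = (\<integral>x. cmod (f x) powr p \<partial>M) powr (1 / p)"
proof -
  have i: "integrable M (\<lambda>x. cmod (f x) powr p)" using assms by (simp add: Lp_space_iff)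
  then have "(\<integral>\<^sup>+x. ennreal (cmod (f x) powr p) \<partial>M) = ennreal (\<integral>x. cmod (f x) powr p \<partial>M)"
    by (intro nn_integral_eq_integral) auto
  then show ?thesis using assms(1) by (simp add: Lp_norm_ennreal)
qed

lemma Lp_norm_less_imp_nn_integral:
  assumes "q > 0" "Lp_norm M (ennreal q) f \<le> ennreal b" "b \<ge> 0"
  shows "(\<integral>\<^sup>+x. ennreal (norm (f x) powr q) \<partial>M) \<le> ennreal (b powr q)"
proof -
  define I where "I = (\<integral>\<^sup>+x. ennreal (norm (f x) powr q) \<partial>M)"
  have I: "I \<noteq> \<infinity>" and "ennreal (enn2real I powr (1 / q)) \<le> ennreal b"
    using assms by (auto simp: Lp_norm_ennreal I_def[symmetric] Let_def top_unique split: if_splits)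
  then have "enn2real I powr (1 / q) \<le> b" using assms(3) by simp
  then have "(enn2real I powr (1 / q)) powr q \<le> b powr q" using assms(1) by (intro powr_mono2) auto
  then have "enn2real I \<le> b powr q" using assms(1) by (simp add: powr_powr)
  then have "ennreal (enn2real I) \<le> ennreal (b powr q)" by (rule ennreal_leI)
  moreover have "I = ennreal (enn2real I)" using I by (simp add: less_top)
  ultimately show ?thesis by (simp only: I_def[symmetric])
qed

text \<open>By Markov's inequality the sets where w >= 1/(j+1) have finite measure. The zero set of
  \<open>w\<close> is joined to each of them; it is null for the density.\<close>

lemma sigma_finite_density_support:
  fixes w :: "'a \<Rightarrow> real"
  assumes w: "integrable M w" "\<And>x. w x \<ge> 0"
  shows "sigma_finite_measure (density M (indicator {x\<in>space M. w x \<noteq> 0}))" (is "sigma_finite_measure ?N")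
proof
  have [measurable]: "w \<in> borel_measurable M" using w by auto
  define A where "A j = {x\<in>space M. w x = 0 \<or> 1 / Suc j \<le> w x}" for j
  have A[measurable]: "A j \<in> sets M" for j unfolding A_def by measurable
  have "emeasure ?N (A j) \<noteq> \<infinity>" for j
  proof -
    have "emeasure ?N (A j) = (\<integral>\<^sup>+x. indicator {x\<in>space M. w x \<noteq> 0} x * indicator (A j) x \<partial>M)"
      by (rule emeasure_density) auto
    also have "\<dots> \<le> (\<integral>\<^sup>+x. ennreal (Suc j * w x) \<partial>M)"
    proof (rule nn_integral_mono)
      fix x
      have "1 \<le> Suc j * w x" if "1 / Suc j \<le> w x" using that by (simp add: field_simps)
      then show "(indicator {x\<in>space M. w x \<noteq> 0} x * indicator (A j) x :: ennreal) \<le> ennreal (Suc j * w x)"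
        by (auto simp: A_def indicator_def)
    qed
    also have "\<dots> = ennreal (\<integral>x. Suc j * w x \<partial>M)"
      using w by (intro nn_integral_eq_integral) auto
    finally show ?thesis by (auto simp: top_unique)
  qed
  moreover have "(\<Union>j. A j) = space M"
  proof -
    have "\<exists>j. w x = 0 \<or> 1 / Suc j \<le> w x" for x
      using w(2)[of x] reals_Archimedean[of "w x"]
      by (cases "w x = 0") (auto simp: inverse_eq_divide intro: less_imp_le)
    then show ?thesis by (auto simp: A_def)
  qed
  ultimately show "\<exists>A. countable A \<and> A \<subseteq> sets ?N \<and> \<Union> A = space ?N \<and> (\<forall>a\<in>A. emeasure ?N a \<noteq> \<infinity>)"
    by (intro exI[of _ "range A"]) auto
qed

text \<open>Cauchy-Schwarz separates \<open>s\<close>, whose L^2 norm is uniformly bounded, from the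
  product of \<open>m\<close> and \<open>f\<close>.\<close>

lemma kernel_op_square_le:
  assumes [measurable]: "s x \<in> borel_measurable M" "m x \<in> borel_measurable M" "f \<in> borel_measurable M"
    and k: "\<And>y. y \<in> space M \<Longrightarrow> k x y = s x y * m x y"
    and B: "Lp_norm M 2 (s x) \<le> ennreal B" "B \<ge> 0"
  shows "ennreal ((cmod (kernel_op M k f x))\<^sup>2)
    \<le> ennreal (B\<^sup>2) * (\<integral>\<^sup>+y. ennreal ((cmod (m x y))\<^sup>2 * (cmod (f y))\<^sup>2) \<partial>M)"
proof -
  have s2: "(\<integral>\<^sup>+y. (ennreal (cmod (s x y)))\<^sup>2 \<partial>M) \<le> ennreal (B\<^sup>2)"
  proof -
    have "(\<integral>\<^sup>+y. ennreal (norm (s x y) powr 2) \<partial>M) \<le> ennreal (B powr 2)"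
      by (rule Lp_norm_less_imp_nn_integral) (use B in simp_all)
    then show ?thesis using B(2) by (simp add: ennreal_power)
  qed
  \<comment> \<open>Where the integrand is not integrable, \<open>kernel_op\<close> has the default
    value 0 and the bound is trivial.\<close>
  have "ennreal (cmod (kernel_op M k f x)) \<le> (\<integral>\<^sup>+y. ennreal (cmod (k x y * f y)) \<partial>M)"
    unfolding kernel_op_def by (cases "integrable M (\<lambda>y. k x y * f y)")
      (auto simp: not_integrable_integral_eq intro: integral_norm_bound_ennreal)
  also have "\<dots> = (\<integral>\<^sup>+y. ennreal (cmod (s x y)) * ennreal (cmod (m x y) * cmod (f y)) \<partial>M)"
    by (intro nn_integral_cong) (simp add: k norm_mult mult.assoc flip: ennreal_mult)
  finally have "(ennreal (cmod (kernel_op M k f x)))\<^sup>2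
      \<le> (\<integral>\<^sup>+y. ennreal (cmod (s x y)) * ennreal (cmod (m x y) * cmod (f y)) \<partial>M)\<^sup>2"
    by (rule power_mono) auto
  also have "\<dots> \<le> (\<integral>\<^sup>+y. (ennreal (cmod (s x y)))\<^sup>2 \<partial>M)
      * (\<integral>\<^sup>+y. (ennreal (cmod (m x y) * cmod (f y)))\<^sup>2 \<partial>M)"
    by (rule Cauchy_Schwarz_nn_integral) auto
  also have "\<dots> \<le> ennreal (B\<^sup>2) * (\<integral>\<^sup>+y. ennreal ((cmod (m x y))\<^sup>2 * (cmod (f y))\<^sup>2) \<partial>M)"
    by (rule mult_mono[OF s2]) (auto simp: ennreal_power power_mult_distrib)
  finally show ?thesis by (simp add: ennreal_power)
qed

text \<open>\<open>M\<close> need not be sigma-finite, so Tonelli's theorem is applied on the set where the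
  integrable function \<open>w + |f|\<^sup>p\<close> is positive, which carries both \<open>f\<close> and the weight \<open>g\<close>.\<close>

lemma nn_integral_weighted_kernel_op_le:
  fixes g w :: "'a \<Rightarrow> real"
  assumes s: "case_prod s \<in> borel_measurable (M \<Otimes>\<^sub>M M)" and m: "case_prod m \<in> borel_measurable (M \<Otimes>\<^sub>M M)"
    and k: "\<And>x y. x \<in> space M \<Longrightarrow> y \<in> space M \<Longrightarrow> k x y = s x y * m x y"
    and B: "\<And>x. x \<in> space M \<Longrightarrow> Lp_norm M 2 (s x) \<le> ennreal B" "B \<ge> 0"
    and f[measurable]: "f \<in> borel_measurable M" and fp: "integrable M (\<lambda>x. cmod (f x) powr p)"
    and g[measurable]: "g \<in> borel_measurable M" and g0: "\<And>x. g x \<ge> 0"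
    and w: "integrable M w" "\<And>x. w x \<ge> 0" and gw: "\<And>x. w x = 0 \<Longrightarrow> g x = 0"
  shows "(\<integral>\<^sup>+x. ennreal (g x * (cmod (kernel_op M k f x))\<^sup>2) \<partial>M)
    \<le> ennreal (B\<^sup>2) * (\<integral>\<^sup>+y. ennreal ((cmod (f y))\<^sup>2) * (\<integral>\<^sup>+x. ennreal ((cmod (m x y))\<^sup>2 * g x) \<partial>M) \<partial>M)"
proof -
  define A where "A = {x\<in>space M. w x + cmod (f x) powr p \<noteq> 0}"
  define N where "N = density M (indicator A)"
  have wm[measurable]: "w \<in> borel_measurable M" using w(1) by auto
  have A[measurable]: "A \<in> sets M" unfolding A_def by measurable
  interpret N: sigma_finite_measure N
    unfolding N_def A_def using w fp by (intro sigma_finite_density_support) auto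
  interpret NN: pair_sigma_finite N N ..
  have zero: "g x = 0" "f x = 0" if "x \<in> space M" "x \<notin> A" for x
  proof -
    have "w x + cmod (f x) powr p = 0" using that by (simp add: A_def)
    then have "w x = 0" "cmod (f x) powr p = 0"
      using w(2)[of x] by (auto simp: add_nonneg_eq_0_iff)
    then show "g x = 0" "f x = 0" using gw by auto
  qed
  have sets_N[measurable_cong]: "sets N = sets M" by (simp add: N_def)
  have sp_N: "space N = space M" by (simp add: N_def)
  \<comment> \<open>Allows passing to \<open>N\<close> for Tonelli and back: off \<open>A\<close>
    the integrands vanish, in the variable x because of \<open>g\<close> and in y because of
    \<open>f\<close>.\<close>
  have NM: "(\<integral>\<^sup>+x. h x \<partial>N) = (\<integral>\<^sup>+x. h x \<partial>M)"
    if "h \<in> borel_measurable M" "\<And>x. x \<in> space M \<Longrightarrow> x \<notin> A \<Longrightarrow> h x = 0" for h :: "'a \<Rightarrow> ennreal"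
  proof -
    have "(\<integral>\<^sup>+x. h x \<partial>N) = (\<integral>\<^sup>+x. indicator A x * h x \<partial>M)"
      unfolding N_def using that by (intro nn_integral_density) auto
    also have "\<dots> = (\<integral>\<^sup>+x. h x \<partial>M)"
      using that(2) by (intro nn_integral_cong) (auto simp: indicator_def)
    finally show ?thesis .
  qed
  have [measurable]: "(\<lambda>y. s x y) \<in> borel_measurable M" "(\<lambda>y. m x y) \<in> borel_measurable M" if "x \<in> space M" for x
    using measurable_Pair2[OF s that] measurable_Pair2[OF m that] by simp_all
  have my: "(\<lambda>x. m x y) \<in> borel_measurable M" if "y \<in> space M" for y
    using measurable_Pair1[OF m that] by simp
  have mN[measurable]: "case_prod m \<in> borel_measurable (N \<Otimes>\<^sub>M N)"
    using m by (simp cong: measurable_cong_sets add: sets_pair_measure_cong[OF sets_N sets_N])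
  define \<Phi> where "\<Phi> x y = ennreal (g x) * ennreal ((cmod (m x y))\<^sup>2 * (cmod (f y))\<^sup>2)" for x y
  have [measurable]: "f \<in> borel_measurable N" "g \<in> borel_measurable N" by measurable
  have \<Phi>[measurable]: "case_prod \<Phi> \<in> borel_measurable (N \<Otimes>\<^sub>M N)"
    unfolding \<Phi>_def by measurable
  have "(\<integral>\<^sup>+x. ennreal (g x * (cmod (kernel_op M k f x))\<^sup>2) \<partial>M)
      \<le> (\<integral>\<^sup>+x. ennreal (B\<^sup>2) * (\<integral>\<^sup>+y. \<Phi> x y \<partial>N) \<partial>M)"
  proof (rule nn_integral_mono)
    fix x assume x: "x \<in> space M"
    have "ennreal (g x * (cmod (kernel_op M k f x))\<^sup>2)
        = ennreal (g x) * ennreal ((cmod (kernel_op M k f x))\<^sup>2)"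
      using g0 by (simp add: ennreal_mult)
    also have "\<dots> \<le> ennreal (g x)
        * (ennreal (B\<^sup>2) * (\<integral>\<^sup>+y. ennreal ((cmod (m x y))\<^sup>2 * (cmod (f y))\<^sup>2) \<partial>M))"
      using x k B by (intro mult_left_mono kernel_op_square_le[where s = s]) auto
    also have "(\<integral>\<^sup>+y. ennreal ((cmod (m x y))\<^sup>2 * (cmod (f y))\<^sup>2) \<partial>M)
        = (\<integral>\<^sup>+y. ennreal ((cmod (m x y))\<^sup>2 * (cmod (f y))\<^sup>2) \<partial>N)"
      using x zero by (intro NM[symmetric]) auto
    also have "ennreal (g x) * (ennreal (B\<^sup>2) * \<dots>) = ennreal (B\<^sup>2) * (\<integral>\<^sup>+y. \<Phi> x y \<partial>N)"
      using x unfolding \<Phi>_def by (subst nn_integral_cmult) (auto simp: ac_simps)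
    finally show "ennreal (g x * (cmod (kernel_op M k f x))\<^sup>2) \<le> ennreal (B\<^sup>2) * (\<integral>\<^sup>+y. \<Phi> x y \<partial>N)" .
  qed
  also have "\<dots> = (\<integral>\<^sup>+x. ennreal (B\<^sup>2) * (\<integral>\<^sup>+y. \<Phi> x y \<partial>N) \<partial>N)"
    using zero by (intro NM[symmetric]) (auto simp: \<Phi>_def)
  also have "\<dots> = ennreal (B\<^sup>2) * (\<integral>\<^sup>+x. (\<integral>\<^sup>+y. \<Phi> x y \<partial>N) \<partial>N)"
    by (intro nn_integral_cmult) measurable
  also have "(\<integral>\<^sup>+x. (\<integral>\<^sup>+y. \<Phi> x y \<partial>N) \<partial>N) = (\<integral>\<^sup>+y. (\<integral>\<^sup>+x. \<Phi> x y \<partial>N) \<partial>N)"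
    by (rule NN.Fubini'[symmetric]) (rule \<Phi>)
  also have "\<dots> = (\<integral>\<^sup>+y. (\<integral>\<^sup>+x. \<Phi> x y \<partial>N) \<partial>M)"
    using zero by (intro NM) (auto simp: \<Phi>_def)
  also have "\<dots> = (\<integral>\<^sup>+y. ennreal ((cmod (f y))\<^sup>2) * (\<integral>\<^sup>+x. ennreal ((cmod (m x y))\<^sup>2 * g x) \<partial>M) \<partial>M)"
  proof (rule nn_integral_cong)
    fix y assume y: "y \<in> space M"
    have [measurable]: "(\<lambda>x. m x y) \<in> borel_measurable M" using y by (rule my)
    have "(\<integral>\<^sup>+x. \<Phi> x y \<partial>N) = (\<integral>\<^sup>+x. \<Phi> x y \<partial>M)"
      using y zero my[OF y] by (intro NM) (auto simp: \<Phi>_def)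
    also have "\<dots> = (\<integral>\<^sup>+x. ennreal ((cmod (f y))\<^sup>2) * ennreal ((cmod (m x y))\<^sup>2 * g x) \<partial>M)"
      using g0 by (intro nn_integral_cong) (simp add: \<Phi>_def ac_simps flip: ennreal_mult)
    also have "\<dots> = ennreal ((cmod (f y))\<^sup>2) * (\<integral>\<^sup>+x. ennreal ((cmod (m x y))\<^sup>2 * g x) \<partial>M)"
      by (intro nn_integral_cmult) measurable
    finally show "(\<integral>\<^sup>+x. \<Phi> x y \<partial>N) = ennreal ((cmod (f y))\<^sup>2) * (\<integral>\<^sup>+x. ennreal ((cmod (m x y))\<^sup>2 * g x) \<partial>M)" .
  qed
  finally show ?thesis .
qed

text \<open>Identifies the inner integral left by Tonelli with the operator of the maximal
  inequality: integration in the first variable of \<open>m\<close> is the action of the flipped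
  kernel. Integrability excludes the default value 0 on the right.\<close>

lemma nn_integral_eq_kernel_op:
  fixes g :: "'a \<Rightarrow> real"
  assumes "\<And>x. g x \<ge> 0"
    and "integrable M (\<lambda>x. complex_of_real ((cmod (flip_kernel m y x))\<^sup>2) * complex_of_real (g x))"
  shows "(\<integral>\<^sup>+x. ennreal ((cmod (m x y))\<^sup>2 * g x) \<partial>M) =
    ennreal (cmod (kernel_op M (\<lambda>x y. complex_of_real ((cmod (flip_kernel m x y))\<^sup>2)) (\<lambda>x. complex_of_real (g x)) y))"
proof -
  have *: "integrable M (\<lambda>x. (cmod (m x y))\<^sup>2 * g x)"
    using assms(2) by (subst (asm) of_real_mult[symmetric], subst (asm) complex_of_real_integrable_eq)
      (simp add: flip_kernel_def)
  have "kernel_op M (\<lambda>x y. complex_of_real ((cmod (flip_kernel m x y))\<^sup>2)) (\<lambda>x. complex_of_real (g x)) y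
      = complex_of_real (\<integral>x. (cmod (m x y))\<^sup>2 * g x \<partial>M)"
    unfolding kernel_op_def flip_kernel_def of_real_mult[symmetric] by (rule integral_complex_of_real)
  moreover have "(\<integral>x. (cmod (m x y))\<^sup>2 * g x \<partial>M) \<ge> 0"
    using assms(1) by (intro integral_nonneg_AE) simp
  ultimately show ?thesis using * assms(1) by (simp add: nn_integral_eq_integral)
qed

section \<open>Square function estimate\<close>

text \<open>The scaling \<open>t\<close> serves to make the second term small enough to be absorbed.\<close>

lemma mult_le_powr_add_powr:
  fixes a b t p :: real
  assumes "p > 2" "a \<ge> 0" "b \<ge> 0" "t > 0"
  shows "a * b \<le> t powr (p / 2) * a powr (p / 2) + t powr (- (p / (p - 2))) * b powr (p / (p - 2))"
proof -
  let ?q = "p / (p - 2)"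
  have "a * b = (t * a) * (b / t)" using assms by simp
  also have "\<dots> \<le> (t * a) powr (p / 2) / (p / 2) + (b / t) powr ?q / ?q"
    using assms by (intro Youngs_inequality) (auto simp: field_simps)
  also have "\<dots> \<le> (t * a) powr (p / 2) + (b / t) powr ?q"
  proof (intro add_mono)
    have *: "u / r \<le> u" if "u \<ge> 0" "r \<ge> 1" for u r :: real
      using that by (simp add: divide_le_eq mult_le_cancel_left1)
    show "(t * a) powr (p / 2) / (p / 2) \<le> (t * a) powr (p / 2)"
      by (rule *) (use assms in auto)
    show "(b / t) powr ?q / ?q \<le> (b / t) powr ?q"
      by (rule *) (use assms in auto)
  qed
  also have "\<dots> = t powr (p / 2) * a powr (p / 2) + t powr (- ?q) * b powr ?q"
    using assms by (simp add: powr_mult powr_divide powr_minus divide_simps)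
  finally show ?thesis .
qed

text \<open>An infimum yields an actual majorant only below a strict bound, which is why the
  constant is enlarged to \<open>C1\<close> before this is applied.\<close>

lemma sup_plus_norm_majorant:
  assumes "sup_plus_norm M q Z F < X"
  obtains G :: "'a \<Rightarrow> real" where "G \<in> borel_measurable M"
    "\<And>z. z \<in> Z \<Longrightarrow> AE x in M. cmod (F z x) \<le> G x" "Lp_norm M q G < X"
  using assms unfolding sup_plus_norm_def by (auto simp: INF_less_iff)

lemma square_function_estimate:
  fixes p :: real and Z :: "'z set" and M :: "'a measure" and k :: "'z \<Rightarrow> 'a \<Rightarrow> 'a \<Rightarrow> complex"
  assumes p: "2 \<le> p"
    and k: "\<And>z. z \<in> Z \<Longrightarrow> bounded_integral_operator M (ennreal p) (k z)"
    and dec: "square_max_decomposition M (if p = 2 then \<infinity> else ennreal (p / (p - 2))) Z k"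
  shows "\<exists>D\<ge>0. \<forall>n \<zeta> f. (\<forall>i<n. \<zeta> i \<in> Z \<and> f i \<in> Lp_space M (ennreal p)) \<longrightarrow>
    square_fun_integral M p n (\<lambda>i. kernel_op M (k (\<zeta> i)) (f i)) \<le> D * square_fun_integral M p n f"
proof -
  define q where "q = (if p = 2 then \<infinity> else ennreal (p / (p - 2)))"
  define K where "K m = (\<lambda>x y. complex_of_real ((cmod (flip_kernel m x y))\<^sup>2))"
    for m :: "'a \<Rightarrow> 'a \<Rightarrow> complex"
  from dec obtain s m C where
    s: "\<And>z. z \<in> Z \<Longrightarrow> case_prod (s z) \<in> borel_measurable (M \<Otimes>\<^sub>M M)" and
    m: "\<And>z. z \<in> Z \<Longrightarrow> case_prod (m z) \<in> borel_measurable (M \<Otimes>\<^sub>M M)" and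
    sm: "\<And>z x y. z \<in> Z \<Longrightarrow> x \<in> space M \<Longrightarrow> y \<in> space M \<Longrightarrow> k z x y = s z x y * m z x y" and
    sB: "(SUP z\<in>Z. SUP x\<in>space M. Lp_norm M 2 (s z x)) < \<infinity>" and
    ex: "\<And>z. z \<in> Z \<Longrightarrow> kernel_op_exists M q (K (m z))" and
    C: "\<And>f. f \<in> Lp_space M q \<Longrightarrow>
      sup_plus_norm M q Z (\<lambda>z. kernel_op M (K (m z)) f) \<le> ennreal C * Lp_norm M q f"
    unfolding square_max_decomposition_def q_def[symmetric] Let_def K_def[symmetric] by blast
  \<comment> \<open>\<open>C\<close> may be any real, even negative; \<open>C1\<close> is positive
    and strictly exceeds its truncation \<open>ennreal C\<close>.\<close>
  define C1 where "C1 = max C 0 + 1"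
  have C1: "C1 > 0" and C_C1: "ennreal C < ennreal C1"
    by (auto simp: C1_def ennreal_less_iff max_def ennreal_neg)
  define B where "B = enn2real (SUP z\<in>Z. SUP x\<in>space M. Lp_norm M 2 (s z x)) + 1"
  have B1: "B > 0" by (simp add: B_def add_nonneg_pos)
  have B: "Lp_norm M 2 (s z x) \<le> ennreal B" if "z \<in> Z" "x \<in> space M" for z x
  proof -
    have "Lp_norm M 2 (s z x) \<le> (SUP z\<in>Z. SUP x\<in>space M. Lp_norm M 2 (s z x))"
      using that by (intro SUP_upper2[of z] SUP_upper2[of x]) auto
    also have "\<dots> = ennreal (enn2real (SUP z\<in>Z. SUP x\<in>space M. Lp_norm M 2 (s z x)))"
      using sB by simp
    also have "\<dots> \<le> ennreal B" by (intro ennreal_leI) (simp add: B_def)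
    finally show ?thesis .
  qed
  define q' where "q' = p / (p - 2)"
  \<comment> \<open>Chosen so that t^(-q') is 1 / (2 B^2 C1^q'), which turns the second Young term
    into H/2. In \<open>D\<close> the first summand serves p > 2, the second p = 2.\<close>
  define t where "t = (2 * B\<^sup>2 * C1 powr q') powr (1 / q')"
  define D where "D = 2 * B\<^sup>2 * t powr (p / 2) + B\<^sup>2 * C1"
  have "square_fun_integral M p n (\<lambda>i. kernel_op M (k (\<zeta> i)) (f i)) \<le> D * square_fun_integral M p n f"
    if f: "\<forall>i<n. \<zeta> i \<in> Z \<and> f i \<in> Lp_space M (ennreal p)" for n \<zeta> f
  proof -
    define h where "h x = (\<Sum>i<n. (cmod (kernel_op M (k (\<zeta> i)) (f i) x))\<^sup>2)" for x
    define S where "S x = (\<Sum>i<n. (cmod (f i x))\<^sup>2)" for x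
    \<comment> \<open>As \<open>0 powr 0 = 0\<close>, for \<open>p = 2\<close> this is the indicator of the support of \<open>h\<close>, a sigma-finite set.\<close>
    define g where "g x = h x powr (p / 2 - 1)" for x
    define H where "H = square_fun_integral M p n (\<lambda>i. kernel_op M (k (\<zeta> i)) (f i))"
    have p0: "p > 0" using p by simp
    have fm[measurable]: "f i \<in> borel_measurable M"
      and fi: "integrable M (\<lambda>x. cmod (f i x) powr p)" if "i < n" for i
      using f that p0 by (auto simp: Lp_space_iff)
    have Tf: "kernel_op M (k (\<zeta> i)) (f i) \<in> Lp_space M (ennreal p)" if "i < n" for i
      using k[of "\<zeta> i"] f that by (auto simp: bounded_integral_operator_def bounded_operator_def)
    have Tm: "kernel_op M (k (\<zeta> i)) (f i) \<in> borel_measurable M"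
      and Ti: "integrable M (\<lambda>x. cmod (kernel_op M (k (\<zeta> i)) (f i) x) powr p)" if "i < n" for i
      using Tf[OF that] p0 by (auto simp: Lp_space_iff)
    have h0: "h x \<ge> 0" and S0: "S x \<ge> 0" and g0: "g x \<ge> 0" for x
      by (auto simp: h_def S_def g_def intro: sum_nonneg)
    have hm[measurable]: "h \<in> borel_measurable M"
      unfolding h_def using p0 Tm Ti by (rule measurable_square_sum)
    have [measurable]: "S \<in> borel_measurable M"
      unfolding S_def using p0 fm fi by (rule measurable_square_sum)
    have gm[measurable]: "g \<in> borel_measurable M" unfolding g_def by measurable
    have hi: "integrable M (\<lambda>x. h x powr (p / 2))"
      unfolding h_def using p0 Tm Ti by (rule integrable_square_fun)
    have Si: "integrable M (\<lambda>x. S x powr (p / 2))"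
      unfolding S_def using p0 fm fi by (rule integrable_square_fun)
    have H: "H = (\<integral>x. h x powr (p / 2) \<partial>M)" by (simp add: H_def square_fun_integral_def h_def)
    have H0: "H \<ge> 0" by (simp add: H)
    define I where "I = square_fun_integral M p n f"
    have I: "I = (\<integral>x. S x powr (p / 2) \<partial>M)" by (simp add: I_def square_fun_integral_def S_def)
    have I0: "I \<ge> 0" by (simp add: I)
    have gh: "g x * h x = h x powr (p / 2)" for x
      using h0[of x] by (cases "h x = 0") (simp_all add: g_def powr_diff)

    \<comment> \<open>One \<open>G\<close> dominates for all indices, so the sum over
      \<open>i\<close> can be taken inside the integral, where it becomes \<open>S\<close>.\<close>
    have le: "ennreal H \<le> ennreal (B\<^sup>2) * (\<integral>\<^sup>+y. ennreal (S y * G y) \<partial>M)"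
      if gL: "(\<lambda>x. complex_of_real (g x)) \<in> Lp_space M q"
        and [measurable]: "G \<in> borel_measurable M"
        and G: "\<And>z. z \<in> Z \<Longrightarrow> AE x in M. cmod (kernel_op M (K (m z)) (\<lambda>x. complex_of_real (g x)) x) \<le> G x"
      for G :: "'a \<Rightarrow> real"
    proof -
      have "ennreal H = (\<integral>\<^sup>+x. ennreal (h x powr (p / 2)) \<partial>M)"
        unfolding H using hi by (intro nn_integral_eq_integral[symmetric]) auto
      also have "\<dots> = (\<integral>\<^sup>+x. (\<Sum>i<n. ennreal (g x * (cmod (kernel_op M (k (\<zeta> i)) (f i) x))\<^sup>2)) \<partial>M)"
      proof (intro nn_integral_cong)
        fix x
        have "h x powr (p / 2) = (\<Sum>i<n. g x * (cmod (kernel_op M (k (\<zeta> i)) (f i) x))\<^sup>2)"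
          unfolding gh[symmetric] by (simp add: h_def sum_distrib_left)
        then show "ennreal (h x powr (p / 2))
            = (\<Sum>i<n. ennreal (g x * (cmod (kernel_op M (k (\<zeta> i)) (f i) x))\<^sup>2))"
          by (simp add: g0 sum_ennreal)
      qed
      also have "\<dots> = (\<Sum>i<n. \<integral>\<^sup>+x. ennreal (g x * (cmod (kernel_op M (k (\<zeta> i)) (f i) x))\<^sup>2) \<partial>M)"
        using Tm by (intro nn_integral_sum) auto
      also have "\<dots> \<le> (\<Sum>i<n. ennreal (B\<^sup>2) * (\<integral>\<^sup>+y. ennreal ((cmod (f i y))\<^sup>2 * G y) \<partial>M))"
      proof (rule sum_mono)
        fix i assume "i \<in> {..<n}"
        then have i: "i < n" and z: "\<zeta> i \<in> Z" using f by auto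
        have "(\<integral>\<^sup>+x. ennreal (g x * (cmod (kernel_op M (k (\<zeta> i)) (f i) x))\<^sup>2) \<partial>M)
          \<le> ennreal (B\<^sup>2) * (\<integral>\<^sup>+y. ennreal ((cmod (f i y))\<^sup>2)
              * (\<integral>\<^sup>+x. ennreal ((cmod (m (\<zeta> i) x y))\<^sup>2 * g x) \<partial>M) \<partial>M)"
          \<comment> \<open>The function \<open>g\<close> need not be integrable, whereas h^(p/2)
            is, and it has the same zeros.\<close>
          by (rule nn_integral_weighted_kernel_op_le[where w = "\<lambda>x. h x powr (p / 2)" and p = p,
                OF s[OF z] m[OF z] sm[OF z] B[OF z]])
             (use B1 fm[OF i] fi[OF i] g0 hi in \<open>auto simp: g_def\<close>)
        also have "(\<integral>\<^sup>+y. ennreal ((cmod (f i y))\<^sup>2)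
              * (\<integral>\<^sup>+x. ennreal ((cmod (m (\<zeta> i) x y))\<^sup>2 * g x) \<partial>M) \<partial>M)
            \<le> (\<integral>\<^sup>+y. ennreal ((cmod (f i y))\<^sup>2 * G y) \<partial>M)"
        proof (rule nn_integral_mono_AE)
          have "AE y in M. integrable M (\<lambda>x. K (m (\<zeta> i)) y x * complex_of_real (g x))"
            using ex[OF z] gL by (auto simp: kernel_op_exists_def)
          with G[OF z] show "AE y in M. ennreal ((cmod (f i y))\<^sup>2)
              * (\<integral>\<^sup>+x. ennreal ((cmod (m (\<zeta> i) x y))\<^sup>2 * g x) \<partial>M)
              \<le> ennreal ((cmod (f i y))\<^sup>2 * G y)"
          proof eventually_elim
            case (elim y)
            then have "(\<integral>\<^sup>+x. ennreal ((cmod (m (\<zeta> i) x y))\<^sup>2 * g x) \<partial>M) \<le> ennreal (G y)"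
              unfolding K_def by (subst nn_integral_eq_kernel_op[OF g0]) (auto intro: ennreal_leI)
            then show ?case by (simp add: ennreal_mult' mult_left_mono)
          qed
        qed
        finally show "(\<integral>\<^sup>+x. ennreal (g x * (cmod (kernel_op M (k (\<zeta> i)) (f i) x))\<^sup>2) \<partial>M)
          \<le> ennreal (B\<^sup>2) * (\<integral>\<^sup>+y. ennreal ((cmod (f i y))\<^sup>2 * G y) \<partial>M)"
          by (simp add: mult_left_mono)
      qed
      also have "\<dots> = ennreal (B\<^sup>2) * (\<integral>\<^sup>+y. (\<Sum>i<n. ennreal ((cmod (f i y))\<^sup>2 * G y)) \<partial>M)"
        using fm by (subst nn_integral_sum) (auto simp: sum_distrib_left)
      also have "(\<integral>\<^sup>+y. (\<Sum>i<n. ennreal ((cmod (f i y))\<^sup>2 * G y)) \<partial>M) = (\<integral>\<^sup>+y. ennreal (S y * G y) \<partial>M)"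
        by (intro nn_integral_cong)
           (simp add: S_def ennreal_mult' sum_distrib_right[symmetric] sum_ennreal sum_nonneg)
      finally show ?thesis .
    qed

    show ?thesis
    proof (cases "p = 2")
      case True
      then have q: "q = \<infinity>" by (simp add: q_def)
      have g1: "g x \<le> 1" for x using True by (simp add: g_def)
      have gN: "Lp_norm M q (\<lambda>x. complex_of_real (g x)) \<le> 1"
        unfolding Lp_norm_def q using g0 g1 by (auto intro!: esssup_I AE_I2)
      then have gL: "(\<lambda>x. complex_of_real (g x)) \<in> Lp_space M q"
        by (auto simp: Lp_space_def intro: le_less_trans)
      have "sup_plus_norm M q Z (\<lambda>z. kernel_op M (K (m z)) (\<lambda>x. complex_of_real (g x))) \<le> ennreal C * 1"
        using C[OF gL] gN by (meson mult_left_mono order_trans zero_le)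
      also have "\<dots> < ennreal C1" using C_C1 by simp
      finally obtain G where G: "G \<in> borel_measurable M"
        "\<And>z. z \<in> Z \<Longrightarrow> AE x in M. cmod (kernel_op M (K (m z)) (\<lambda>x. complex_of_real (g x)) x) \<le> G x"
        "Lp_norm M q G < ennreal C1" by (rule sup_plus_norm_majorant) blast
      have "AE y in M. ennreal (norm (G y)) \<le> ennreal C1"
        using esssup_AE[of "\<lambda>x. ennreal (norm (G x))" M] G(3) unfolding Lp_norm_def q
        by (auto elim!: eventually_mono)
      then have GC: "AE y in M. G y \<le> C1"
        using C1 by (auto elim!: eventually_mono)
      have "ennreal H \<le> ennreal (B\<^sup>2) * (\<integral>\<^sup>+y. ennreal (S y * G y) \<partial>M)" by (rule le[OF gL G(1,2)])
      also have "\<dots> \<le> ennreal (B\<^sup>2) * (\<integral>\<^sup>+y. ennreal (C1 * S y powr (p / 2)) \<partial>M)"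
      proof (intro mult_left_mono nn_integral_mono_AE)
        from GC show "AE y in M. ennreal (S y * G y) \<le> ennreal (C1 * S y powr (p / 2))"
          by eventually_elim (auto intro!: ennreal_leI mult_left_mono simp: S0 True mult.commute[of C1])
      qed auto
      also have "\<dots> = ennreal (B\<^sup>2 * (C1 * I))"
        using Si C1 I0 by (subst nn_integral_eq_integral) (auto simp: I ennreal_mult'')
      finally have "H \<le> B\<^sup>2 * (C1 * I)" using C1 I0 by simp
      also have "\<dots> \<le> D * I" using I0 by (simp add: D_def algebra_simps)
      finally show ?thesis by (simp add: H_def I_def)
    next
      case False
      then have p2: "p > 2" using p by simp
      then have q: "q = ennreal q'" and q'0: "q' > 0" by (simp_all add: q_def q'_def)
      have t0: "t > 0" using B1 C1 by (simp add: t_def)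
      \<comment> \<open>Since (p/2 - 1) q' = p/2, the norm of \<open>g\<close> is H^(1/q').\<close>
      have gq: "norm (complex_of_real (g x)) powr q' = h x powr (p / 2)" for x
      proof -
        have e: "(p / 2 - 1) * q' = p / 2" using p2 by (simp add: q'_def field_simps)
        have "norm (complex_of_real (g x)) powr q' = g x powr q'" using g0 by simp
        also have "\<dots> = h x powr (p / 2)" by (simp only: g_def powr_powr e)
        finally show ?thesis .
      qed
      have gL: "(\<lambda>x. complex_of_real (g x)) \<in> Lp_space M q"
        unfolding q using q'0 hi by (simp add: Lp_space_iff gq del: norm_of_real)
      have "(\<integral>\<^sup>+x. ennreal (h x powr (p / 2)) \<partial>M) = ennreal H"
        unfolding H using hi by (intro nn_integral_eq_integral) auto
      then have gN: "Lp_norm M q (\<lambda>x. complex_of_real (g x)) = ennreal (H powr (1 / q'))"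
        unfolding q using q'0 H0 by (simp add: Lp_norm_ennreal gq del: norm_of_real)
      show ?thesis
      \<comment> \<open>For H = 0 the strict inequality needed to select \<open>G\<close> would
        fail.\<close>
      proof (cases "H = 0")
        case True
        then show ?thesis using I0 C1 by (simp add: H_def[symmetric] I_def[symmetric] D_def)
      next
        case False
        with H0 have H_pos: "H > 0" by simp
        have "sup_plus_norm M q Z (\<lambda>z. kernel_op M (K (m z)) (\<lambda>x. complex_of_real (g x)))
            \<le> ennreal C * ennreal (H powr (1 / q'))"
          using C[OF gL] gN by simp
        also have "\<dots> < ennreal C1 * ennreal (H powr (1 / q'))"
          using C_C1 H_pos by (intro ennreal_mult_strict_right_mono) auto
        also have "\<dots> = ennreal (C1 * H powr (1 / q'))" using C1 by (simp add: ennreal_mult')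
        finally obtain G where G[measurable]: "G \<in> borel_measurable M"
          and G2: "\<And>z. z \<in> Z \<Longrightarrow> AE x in M. cmod (kernel_op M (K (m z)) (\<lambda>x. complex_of_real (g x)) x) \<le> G x"
          and G3: "Lp_norm M q G < ennreal (C1 * H powr (1 / q'))" by (rule sup_plus_norm_majorant) blast
        have "(\<integral>\<^sup>+x. ennreal (norm (G x) powr q') \<partial>M) \<le> ennreal ((C1 * H powr (1 / q')) powr q')"
          using G3 C1 by (intro Lp_norm_less_imp_nn_integral q'0) (auto simp: q)
        also have "(C1 * H powr (1 / q')) powr q' = C1 powr q' * H"
          using C1 H_pos q'0 by (simp add: powr_mult powr_powr)
        finally have Gq: "(\<integral>\<^sup>+x. ennreal (\<bar>G x\<bar> powr q') \<partial>M) \<le> ennreal (C1 powr q' * H)" by simp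
        have "ennreal H \<le> ennreal (B\<^sup>2) * (\<integral>\<^sup>+y. ennreal (S y * G y) \<partial>M)" by (rule le[OF gL G G2])
        also have "\<dots> \<le> ennreal (B\<^sup>2) * (\<integral>\<^sup>+y. ennreal (t powr (p / 2) * S y powr (p / 2))
            + ennreal (t powr (- q')) * ennreal (\<bar>G y\<bar> powr q') \<partial>M)"
        proof (intro mult_left_mono nn_integral_mono)
          fix y
          \<comment> \<open>A majorant is controlled only almost everywhere; its absolute value lets
            Young's inequality hold at every point.\<close>
          have "S y * G y \<le> S y * \<bar>G y\<bar>" using S0 by (intro mult_left_mono) auto
          also have "\<dots> \<le> t powr (p / 2) * S y powr (p / 2) + t powr (- q') * \<bar>G y\<bar> powr q'"
            unfolding q'_def using p2 t0 S0 by (intro mult_le_powr_add_powr) auto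
          finally show "ennreal (S y * G y) \<le> ennreal (t powr (p / 2) * S y powr (p / 2))
            + ennreal (t powr (- q')) * ennreal (\<bar>G y\<bar> powr q')"
            by (simp add: ennreal_leI flip: ennreal_plus ennreal_mult')
        qed auto
        also have "\<dots> = ennreal (B\<^sup>2) * (ennreal (t powr (p / 2) * I)
            + ennreal (t powr (- q')) * (\<integral>\<^sup>+y. ennreal (\<bar>G y\<bar> powr q') \<partial>M))"
          using Si by (simp add: nn_integral_add nn_integral_cmult nn_integral_eq_integral I)
        also have "\<dots> \<le> ennreal (B\<^sup>2) * (ennreal (t powr (p / 2) * I)
            + ennreal (t powr (- q')) * ennreal (C1 powr q' * H))"
          by (intro mult_left_mono add_left_mono Gq) auto
        also have "\<dots> = ennreal (B\<^sup>2 * (t powr (p / 2) * I + t powr (- q') * (C1 powr q' * H)))"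
          using I0 H0 by (simp add: flip: ennreal_plus ennreal_mult')
        finally have "H \<le> B\<^sup>2 * (t powr (p / 2) * I + t powr (- q') * (C1 powr q' * H))"
          using I0 H0 by simp
        also have "t powr (- q') = 1 / (2 * B\<^sup>2 * C1 powr q')"
          using q'0 B1 C1 by (simp add: t_def powr_powr powr_minus divide_simps)
        also have "B\<^sup>2 * (t powr (p / 2) * I + 1 / (2 * B\<^sup>2 * C1 powr q') * (C1 powr q' * H))
            = B\<^sup>2 * t powr (p / 2) * I + H / 2"
          using B1 C1 by (simp add: field_simps)
        \<comment> \<open>Absorption of H/2. By \<open>hi\<close>, \<open>H\<close> is the true,
          finite integral of h^(p/2).\<close>
        finally have "H \<le> 2 * B\<^sup>2 * t powr (p / 2) * I" by simp
        also have "\<dots> \<le> D * I" using I0 C1 by (intro mult_right_mono) (auto simp: D_def)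
        finally show ?thesis by (simp add: H_def I_def)
      qed
    qed
  qed
  moreover have "D \<ge> 0" using C1 by (simp add: D_def)
  ultimately show ?thesis by blast
qed

section \<open>\<open>R\<close>-boundedness\<close>

lemma sum_scaleR_fun_apply:
  "(\<Sum>i<n. c i *\<^sub>R f i) = (\<lambda>x. \<Sum>i<n. c i *\<^sub>R f i x)" for f :: "nat \<Rightarrow> 'a \<Rightarrow> 'b::real_vector"
  by (induction n) (auto simp: fun_eq_iff scaleR_fun_def zero_fun_def)

text \<open>The seminorm of a signed sum is the p-th root of its \<open>signed_sum_integral\<close>,
  whence the exponent r/p.\<close>

lemma Lp_norm_rademacher_sum:
  fixes f :: "nat \<Rightarrow> 'a \<Rightarrow> complex"
  assumes R: "rademacher_sequence P \<epsilon>" and p: "p > 0" and r: "r > 0"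
    and f: "\<forall>i<n. f i \<in> Lp_space M (ennreal p)"
  shows "Lp_norm P (ennreal r) (\<lambda>\<omega>. enn2real (Lp_norm M (ennreal p) (\<Sum>i<n. \<epsilon> i \<omega> *\<^sub>R f i)))
    = ennreal (((\<Sum>\<sigma>\<in>sign_vectors n. signed_sum_integral M p n f \<sigma> powr (r / p)) / 2 ^ n) powr (1 / r))"
proof -
  have fm: "\<And>i. i < n \<Longrightarrow> f i \<in> borel_measurable M"
    and fi: "\<And>i. i < n \<Longrightarrow> integrable M (\<lambda>x. cmod (f i x) powr p)"
    using f p by (auto simp: Lp_space_iff)
  let ?Y = "signed_sum_integral M p n f" and ?N = "\<lambda>F. enn2real (Lp_norm M (ennreal p) F)"
  have N: "norm (?N (\<Sum>i<n. \<sigma> i *\<^sub>R f i)) powr r = ?Y \<sigma> powr (r / p)" for \<sigma> :: "nat \<Rightarrow> real"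
  proof -
    have "(\<lambda>x. \<Sum>i<n. \<sigma> i *\<^sub>R f i x) \<in> Lp_space M (ennreal p)"
      using measurable_signed_sum[OF p fm fi] integrable_signed_sum_powr[OF p fm fi] p
      by (simp add: Lp_space_iff)
    then have "?N (\<Sum>i<n. \<sigma> i *\<^sub>R f i) = ?Y \<sigma> powr (1 / p)"
      using p by (simp add: sum_scaleR_fun_apply enn2real_Lp_norm signed_sum_integral_def)
    then show ?thesis using p by (simp add: powr_powr)
  qed
  have "(\<integral>\<^sup>+\<omega>. ennreal (norm (?N (\<Sum>i<n. \<epsilon> i \<omega> *\<^sub>R f i)) powr r) \<partial>P)
      = (\<integral>\<^sup>+\<omega>. ennreal (?Y (restrict (\<lambda>i. \<epsilon> i \<omega>) {..<n}) powr (r / p)) \<partial>P)"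
    unfolding N by (simp add: signed_sum_integral_def)
  also have "\<dots> = (\<Sum>\<sigma>\<in>sign_vectors n. ennreal (?Y \<sigma> powr (r / p)) * ennreal (1 / 2 ^ n))"
    by (rule nn_integral_rademacher[OF R])
  also have "\<dots> = (\<Sum>\<sigma>\<in>sign_vectors n. ennreal (?Y \<sigma> powr (r / p) / 2 ^ n))"
    by (intro sum.cong refl) (simp flip: ennreal_mult')
  also have "\<dots> = ennreal ((\<Sum>\<sigma>\<in>sign_vectors n. ?Y \<sigma> powr (r / p)) / 2 ^ n)"
    by (simp add: sum_divide_distrib sum_ennreal)
  finally show ?thesis using r by (simp add: Lp_norm_ennreal sum_nonneg)
qed

theorem proposition3p4p3:
  fixes M :: "'a measure" and Z :: "'z set" and k :: "'z \<Rightarrow> 'a \<Rightarrow> 'a \<Rightarrow> complex"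
    and p r :: real and P :: "'w measure" and \<epsilon> :: "nat \<Rightarrow> 'w \<Rightarrow> real"
  assumes "2 \<le> p"
    and "\<And>z. z \<in> Z \<Longrightarrow> bounded_integral_operator M (ennreal p) (k z)"
    and "square_max_decomposition M (if p = 2 then \<infinity> else ennreal (p / (p - 2))) Z k"
    and "rademacher_sequence P \<epsilon>" and "1 < r"
  shows "R_bounded P \<epsilon> r (Lp_space M (ennreal p)) (\<lambda>f. enn2real (Lp_norm M (ennreal p) f))
           ((\<lambda>z. kernel_op M (k z)) ` Z)"
proof -
  have p: "p > 0" and r: "r > 0" and \<alpha>: "r / p > 0" using assms(1,5) by auto
  obtain D where D: "D \<ge> 0" "\<And>n \<zeta> f. (\<forall>i<n. \<zeta> i \<in> Z \<and> f i \<in> Lp_space M (ennreal p)) \<Longrightarrow>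
    square_fun_integral M p n (\<lambda>i. kernel_op M (k (\<zeta> i)) (f i)) \<le> D * square_fun_integral M p n f"
    using square_function_estimate[OF assms(1-3)] by blast
  obtain K where K: "K \<ge> 0" and K_upper: "\<And>n f. (\<forall>i<n. f i \<in> Lp_space M (ennreal p)) \<Longrightarrow>
      (\<Sum>\<sigma>\<in>sign_vectors n. signed_sum_integral M p n f \<sigma> powr (r / p))
        \<le> 2 ^ n * K * square_fun_integral M p n f powr (r / p)"
    and K_lower: "\<And>n f. (\<forall>i<n. f i \<in> Lp_space M (ennreal p)) \<Longrightarrow>
      2 ^ n * square_fun_integral M p n f powr (r / p)
        \<le> K * (\<Sum>\<sigma>\<in>sign_vectors n. signed_sum_integral M p n f \<sigma> powr (r / p))"
    using kahane_khintchine[OF assms(1) \<alpha>, where 'a = 'a] p unfolding Lp_space_iff[OF p] by blast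
  \<comment> \<open>One \<open>K\<close> comes from the upper and one from the lower Kahane
    estimate, the power of \<open>D\<close> from the square functions; the outer root undoes the
    r-th power.\<close>
  define C where "C = (K * K * D powr (r / p)) powr (1 / r)"
  have bo: "bounded_operator (Lp_space M (ennreal p)) (\<lambda>f. enn2real (Lp_norm M (ennreal p) f))
      (kernel_op M (k z))" if "z \<in> Z" for z
    using assms(2)[OF that] by (simp add: bounded_integral_operator_def)
  have "Lp_norm P (ennreal r) (\<lambda>\<omega>. enn2real (Lp_norm M (ennreal p) (\<Sum>i<n. \<epsilon> i \<omega> *\<^sub>R T i (f i))))
      \<le> ennreal C * Lp_norm P (ennreal r) (\<lambda>\<omega>. enn2real (Lp_norm M (ennreal p) (\<Sum>i<n. \<epsilon> i \<omega> *\<^sub>R f i)))"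
    if T: "\<forall>i<n. T i \<in> (\<lambda>z. kernel_op M (k z)) ` Z \<and> f i \<in> Lp_space M (ennreal p)" for n T f
  proof -
    from T have f: "\<forall>i<n. f i \<in> Lp_space M (ennreal p)" by blast
    from T have "\<forall>i\<in>{..<n}. \<exists>z. z \<in> Z \<and> T i = kernel_op M (k z)" by blast
    from bchoice[OF this] obtain \<zeta> where "\<forall>i\<in>{..<n}. \<zeta> i \<in> Z \<and> T i = kernel_op M (k (\<zeta> i))" by blast
    then have \<zeta>: "\<And>i. i < n \<Longrightarrow> \<zeta> i \<in> Z" "\<And>i. i < n \<Longrightarrow> T i = kernel_op M (k (\<zeta> i))" by auto
    define Tf where "Tf i = kernel_op M (k (\<zeta> i)) (f i)" for i
    have Tf: "\<forall>i<n. Tf i \<in> Lp_space M (ennreal p)"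
      using bo[OF \<zeta>(1)] f by (auto simp: Tf_def bounded_operator_def)
    let ?E = "\<lambda>f. \<Sum>\<sigma>\<in>sign_vectors n. signed_sum_integral M p n f \<sigma> powr (r / p)"
    have sq0: "square_fun_integral M p n f \<ge> 0" for f by (simp add: square_fun_integral_def)
    have "?E Tf \<le> 2 ^ n * K * square_fun_integral M p n Tf powr (r / p)" by (rule K_upper[OF Tf])
    also have "\<dots> \<le> 2 ^ n * K * (D * square_fun_integral M p n f) powr (r / p)"
      unfolding Tf_def using \<alpha> K D(2) \<zeta>(1) f sq0 by (intro mult_left_mono powr_mono2) auto
    also have "\<dots> = K * D powr (r / p) * (2 ^ n * square_fun_integral M p n f powr (r / p))"
      using D(1) sq0 by (simp add: powr_mult)
    also have "\<dots> \<le> K * D powr (r / p) * (K * ?E f)"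
      using K by (intro mult_left_mono K_lower f) auto
    finally have "?E Tf / 2 ^ n \<le> K * K * D powr (r / p) * (?E f / 2 ^ n)"
      by (simp add: divide_right_mono mult.commute mult.left_commute)
    then have "(?E Tf / 2 ^ n) powr (1 / r) \<le> (K * K * D powr (r / p) * (?E f / 2 ^ n)) powr (1 / r)"
      using r by (intro powr_mono2 divide_nonneg_nonneg sum_nonneg) auto
    also have "\<dots> = C * (?E f / 2 ^ n) powr (1 / r)"
      unfolding C_def by (rule powr_mult)
    finally have le: "(?E Tf / 2 ^ n) powr (1 / r) \<le> C * (?E f / 2 ^ n) powr (1 / r)" .
    have eq: "(\<Sum>i<n. \<epsilon> i \<omega> *\<^sub>R T i (f i)) = (\<Sum>i<n. \<epsilon> i \<omega> *\<^sub>R Tf i)" for \<omega>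
      using \<zeta>(2) by (intro sum.cong) (auto simp: Tf_def)
    show ?thesis
      unfolding eq Lp_norm_rademacher_sum[OF assms(4) p r f] Lp_norm_rademacher_sum[OF assms(4) p r Tf]
      using le by (simp add: C_def ennreal_leI flip: ennreal_mult')
  qed
  moreover have "C \<ge> 0" by (simp add: C_def)
  ultimately show ?thesis unfolding R_bounded_def using bo by blast
qed

end
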